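(* Let $m\geq0$, $r\geq2$ and $0\leq i\leq r$ be integers. Then \[ \sum_{s_1\geq\dots\geq s_{r}\geq-\lfloor m/2\rfloor}\frac{q^{s_1^2+\dots+s_{r}^2+m(s_1+\dots+s_{r-1})-s_1-\dots-s_{i}+s_{r-1}-2s_r}(-q)_{m+2s_r}}{(q)_{s_1-s_2}\cdots(q)_{s_{r-2}-s_{r-1}}(q^2;q^2)_{s_{r-1}-s_{r}}}(-1)^{s_r}\begin{bmatrix}m+s_r\\ m+2s_r\end{bmatrix}_{q^2} =\sum_{k=0}^{i}q^{mk}\frac{(q^{2r},q^{(m+1)(r-1)-i+2k},q^{(1-m)r+m+i-2k+1};q^{2r})_\infty}{(q)_\infty}, \] where the sum on the left runs over integers $s_1,\dots,s_r$ and $s_1+\dots+s_i$ is zero when $i=0$.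
   Context: $q$ is a complex number with $|q|<1$. For complex $x$ and base $p$ with $|p|<1$, $(x;p)_\infty=\prod_{j\ge0}(1-xp^j)$, $(x;p)_k=(x;p)_\infty/(xp^k;p)_\infty$ for $k\in\mathbb{Z}$, $(x)_k=(x;q)_k$, and $(x_1,\dots,x_m;p)_\infty=(x_1;p)_\infty\cdots(x_m;p)_\infty$. For integers $N\ge0$ and $j$, $\begin{bmatrix}N\\ j\end{bmatrix}_{p}=\frac{(p;p)_N}{(p;p)_j(p;p)_{N-j}}$ if $0\le j\le N$ and $0$ otherwise.
   Formalization: The range 0≤i≤r is replaced by 0≤i≤r−1, since the identity fails for i=r (e.g. m=0, r=i=2: as q→0 the left side tends to 1, the right side behaves like −1/q); also q≠0 is assumed, because negative powers of q occur. *)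

theory Defs
  imports "HOL-Analysis.Analysis"
begin

definition qpoch_inf :: "complex \<Rightarrow> complex \<Rightarrow> complex" where
  "qpoch_inf x p = (\<Prod>j. 1 - x * p ^ j)"

definition qpoch :: "complex \<Rightarrow> complex \<Rightarrow> int \<Rightarrow> complex" where
  "qpoch x p k = qpoch_inf x p / qpoch_inf (x * p powi k) p"

definition qpoch_inf_list :: "complex list \<Rightarrow> complex \<Rightarrow> complex" where
  "qpoch_inf_list xs p = (\<Prod>x\<leftarrow>xs. qpoch_inf x p)"

definition qbinom :: "complex \<Rightarrow> int \<Rightarrow> int \<Rightarrow> complex" where
  "qbinom p N j =
     (if 0 \<le> j \<and> j \<le> N then qpoch p p N / (qpoch p p j * qpoch p p (N - j)) else 0)"

text \<open>
  Integer tuples \<open>(s 1, \<dots>, s r)\<close> with \<open>s 1 \<ge> \<dots> \<ge> s r \<ge> b\<close>. They are taken extensional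
  (\<open>undefined\<close> outside \<open>{1..r}\<close>), so that each tuple occurs exactly once as an index of a sum.
\<close>
definition desc_tuples :: "nat \<Rightarrow> int \<Rightarrow> (nat \<Rightarrow> int) set" where
  "desc_tuples r b = {s \<in> {1..r} \<rightarrow>\<^sub>E UNIV. (\<forall>j\<in>{1..<r}. s j \<ge> s (j + 1)) \<and> s r \<ge> b}"

end

theory Submission
  imports Defs
begin

text \<open>
  Write \<open>(q)\<^sub>k\<close> with \<open>1/(q)\<^sub>k = 0\<close> for \<open>k < 0\<close> and
  \<open>T\<^sub>n(N) = 1 / ((q)\<^bsub>N-n\<^esub> (q)\<^bsub>N+m+n\<^esub>)\<close>, a Bailey kernel with \<open>a = q\<^sup>m\<close> and \<open>n\<close> ranging over
  all integers. The innermost sum, over \<open>s\<^sub>r\<close>, equals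
  \<open>q\<^bsup>-N\<^esup> \<Sum>\<^sub>n (-1)\<^sup>n q\<^bsup>n\<^sup>2-n\<^esup> T\<^sub>n(N)\<close> with \<open>N = s\<^bsub>r-1\<^esub>\<close>, because both
  sides satisfy the same three-term recurrence in \<open>m\<close>.
  Summing \<open>T\<^sub>n(N) / (q)\<^bsub>M-N\<^esub>\<close> over \<open>N\<close> against \<open>q\<^bsup>N\<^sup>2+mN\<^esup>\<close> reproduces \<open>T\<^sub>n(M)\<close> up to the
  factor \<open>q\<^bsup>n\<^sup>2+mn\<^esup>\<close> (q-Vandermonde). Against \<open>q\<^bsup>N\<^sup>2+(m-1)N\<^esup>\<close> the kernel is no longer reproduced, but
  the family \<open>T\<^sub>n(N) ([d+1]\<^sub>x - q\<^bsup>N+m+n\<^esup> [d]\<^sub>x)\<close>, with \<open>x = q\<^bsup>m+2n\<^esup>\<close> and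
  \<open>[d]\<^sub>x = 1 + x + \<dots> + x\<^bsup>d-1\<^esup>\<close>, is stable with \<open>d\<close> replaced by \<open>d + 1\<close>. Peeling off \<open>s\<^bsub>r-1\<^esub>, \<dots>, s\<^sub>1\<close>
  and letting \<open>M \<rightarrow> \<infinity>\<close> leaves \<open>\<Sum>\<^sub>n (-1)\<^sup>n q\<^bsup>Q(n)\<^esup> [i+1]\<^sub>x\<close>, with \<open>Q\<close> quadratic, and the Jacobi triple
  product sums each of its \<open>i + 1\<close> parts.
\<close>

subsection \<open>Sums against a bilateral Bailey kernel\<close>

definition qfact :: "complex \<Rightarrow> nat \<Rightarrow> complex" where
  "qfact q n = (\<Prod>j=1..n. 1 - q ^ j)"

text \<open>The value 0 at negative \<open>k\<close> lets sums run over all integers while keeping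
  finite support, and makes \<open>iqfact_pred\<close> true for every \<open>k\<close>.\<close>

definition iqfact :: "complex \<Rightarrow> int \<Rightarrow> complex" where
  "iqfact q k = (if k < 0 then 0 else 1 / qfact q (nat k))"

text \<open>The two ends \<open>a\<close> and \<open>b\<close> are independent parameters, so that
  each can be lowered separately. The kernel vanishes outside \<open>-b <= n <= a\<close>, hence
  convergence is never an issue.\<close>

definition wsum :: "complex \<Rightarrow> int \<Rightarrow> int \<Rightarrow> (int \<Rightarrow> complex) \<Rightarrow> complex" where
  "wsum q a b f = (\<Sum>\<^sub>\<infinity>n. f n * (iqfact q (a - n) * iqfact q (b + n)))"

lemma qfact_0 [simp]: "qfact q 0 = 1"
  by (simp add: qfact_def)

lemma qfact_Suc: "qfact q (Suc n) = qfact q n * (1 - q ^ Suc n)"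
  by (simp add: qfact_def)

lemma iqfact_neg [simp]: "k < 0 \<Longrightarrow> iqfact q k = 0"
  by (simp add: iqfact_def)

lemma iqfact_0 [simp]: "iqfact q 0 = 1"
  by (simp add: iqfact_def)

lemma powi_nonneg: "0 \<le> k \<Longrightarrow> (x::complex) powi k = x ^ nat k"
  by (simp add: power_int_def)

lemma power2_powi: "((x::complex)\<^sup>2) powi k = x powi (2 * k)"
  by (simp add: power_int_mult)

lemma minus_one_powi_shift:
  "(-1::complex) powi (n + 1) = - ((-1) powi n)"
  "(-1::complex) powi (n - 1) = - ((-1) powi n)"
  "(-1::complex) powi (- n) = (-1) powi n"
  by (simp_all add: power_int_add power_int_diff power_int_minus_left)

lemma infsum_shift: "(\<Sum>\<^sub>\<infinity>n. f (n + c)) = (\<Sum>\<^sub>\<infinity>n::int. (f n :: complex))"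
  by (rule infsum_reindex_bij_witness[of _ "\<lambda>n. n - c" "\<lambda>n. n + c"]) auto

lemma infsum_reflect: "(\<Sum>\<^sub>\<infinity>n. f (c - n)) = (\<Sum>\<^sub>\<infinity>n::int. (f n :: complex))"
  by (rule infsum_reindex_bij_witness[of _ "\<lambda>n. c - n" "\<lambda>n. c - n"]) auto

lemma summable_on_zero_outside:
  assumes "\<And>n::int. n < a \<or> b < n \<Longrightarrow> f n = (0::complex)"
  shows "f summable_on UNIV"
proof (rule finite_nonzero_values_imp_summable_on)
  have "{n \<in> UNIV. f n \<noteq> 0} \<subseteq> {a..b}"
    using assms by force
  then show "finite {n \<in> UNIV. f n \<noteq> 0}"
    using finite_subset by blast
qed

lemma wsum_summable: "(\<lambda>n. f n * (iqfact q (a - n) * iqfact q (b + n))) summable_on UNIV"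
  by (rule summable_on_zero_outside[of "-b" a]) auto

lemma wsum_add: "wsum q a b (\<lambda>n. f n + g n) = wsum q a b f + wsum q a b g"
  unfolding wsum_def by (subst infsum_add[symmetric]) (auto simp: wsum_summable ring_distribs)

lemma wsum_cmult: "wsum q a b (\<lambda>n. c * f n) = c * wsum q a b f"
  unfolding wsum_def by (subst infsum_cmult_right'[symmetric]) (simp add: mult.assoc)

lemma wsum_uminus: "wsum q a b (\<lambda>n. - f n) = - wsum q a b f"
  using wsum_cmult[of q a b "-1" f] by simp

lemma wsum_diff: "wsum q a b (\<lambda>n. f n - g n) = wsum q a b f - wsum q a b g"
  using wsum_add[of q a b f "\<lambda>n. - g n"] by (simp add: wsum_uminus)

lemma wsum_shift: "wsum q a b f = wsum q (a - 1) (b + 1) (\<lambda>n. f (n + 1))"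
  unfolding wsum_def
  by (subst infsum_shift[of _ 1, symmetric]) (simp add: algebra_simps)

lemma wsum_reflect: "wsum q a b f = wsum q (b + c) (a - c) (\<lambda>n. f (c - n))"
  unfolding wsum_def
  by (subst infsum_reflect[of _ c, symmetric]) (simp add: algebra_simps)

lemma wsum_0_0: "wsum q 0 0 f = f 0"
proof -
  have "wsum q 0 0 f = (\<Sum>\<^sub>\<infinity>n\<in>{0}. f n * (iqfact q (0 - n) * iqfact q (0 + n)))"
    unfolding wsum_def by (rule infsum_cong_neutral) (auto simp: neq_iff)
  then show ?thesis by simp
qed

text \<open>The base is nonzero because exponents range over all integers: additivity of
  \<open>powi\<close> fails at 0. The locale is also instantiated at \<open>q^2\<close> and at
  \<open>q ^ (2 * r)\<close>.\<close>

locale nome =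
  fixes q :: complex
  assumes norm_q: "norm q < 1" and q_nz: "q \<noteq> 0"
begin

lemma power_neq_1: "n > 0 \<Longrightarrow> q ^ n \<noteq> 1"
proof
  assume "n > 0" "q ^ n = 1"
  then have "norm q ^ n = 1" by (metis norm_one norm_power)
  with norm_q \<open>n > 0\<close> show False
    by (metis norm_ge_zero power_Suc_less_one gr0_implies_Suc less_irrefl power_less_one_iff)
qed

lemma powi_neq_1: "k > 0 \<Longrightarrow> q powi k \<noteq> 1"
  using power_neq_1[of "nat k"] by (simp add: powi_nonneg)

lemma nome_power: "n > 0 \<Longrightarrow> nome (q ^ n)"
  by unfold_locales (use norm_q q_nz in \<open>auto simp: norm_power power_less_one_iff\<close>)

lemma qfact_nz: "qfact q n \<noteq> 0"
  using power_neq_1 by (auto simp: qfact_def)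

text \<open>At \<open>k = 0\<close> the factor \<open>1 - q powi 0\<close> vanishes, in agreement
  with the value 0 at \<open>-1\<close>; for negative \<open>k\<close> both sides are 0.\<close>

lemma iqfact_pred: "iqfact q (k - 1) = (1 - q powi k) * iqfact q k"
proof (cases "k > 0")
  case True
  then obtain n where "k = int (Suc n)"
    by (metis gr0_implies_Suc zero_less_imp_eq_int)
  then show ?thesis
    using power_neq_1[of "Suc n"]
    by (simp add: iqfact_def qfact_Suc powi_nonneg nat_add_distrib flip: power_Suc)
next
  case False
  then show ?thesis by (cases "k = 0") auto
qed

lemma iqfact_succ: "iqfact q k = (1 - q powi (k + 1)) * iqfact q (k + 1)"
  using iqfact_pred[of "k + 1"] by simp

lemma qpow_add: "q powi a * q powi b = q powi (a + b)"
  using q_nz by (simp add: power_int_add)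

lemma wsum_pred_left: "wsum q (a - 1) b f = wsum q a b (\<lambda>n. (1 - q powi (a - n)) * f n)"
proof -
  have "iqfact q (a - 1 - n) = (1 - q powi (a - n)) * iqfact q (a - n)" for n
    using iqfact_pred[of "a - n"] by (simp add: algebra_simps)
  then show ?thesis unfolding wsum_def by (simp add: mult_ac)
qed

lemma wsum_pred_right: "wsum q a (b - 1) f = wsum q a b (\<lambda>n. (1 - q powi (b + n)) * f n)"
proof -
  have "iqfact q (b - 1 + n) = (1 - q powi (b + n)) * iqfact q (b + n)" for n
    using iqfact_pred[of "b + n"] by (simp add: algebra_simps)
  then show ?thesis unfolding wsum_def by (simp add: mult_ac)
qed

text \<open>A q-Pascal rule for the kernel:
  \<open>1 - q^(a+b) = (1 - q^(a-n)) + q^(a-n) (1 - q^(b+n))\<close>. Each bracket lowers one end,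
  and a shift of \<open>n\<close> brings the second part to the same kernel as the first.\<close>

lemma wsum_split_left:
  "(1 - q powi (a + b)) * wsum q a b f = wsum q (a - 1) b (\<lambda>n. f n + q powi (a - n - 1) * f (n + 1))"
proof -
  have *: "(1 - q powi (a + b)) * f n =
     (1 - q powi (a - n)) * f n + (1 - q powi (b + n)) * (q powi (a - n) * f n)" for n
    using qpow_add[of "b + n" "a - n"] by (simp add: algebra_simps)
  have "(1 - q powi (a + b)) * wsum q a b f
     = wsum q (a - 1) b f + wsum q a (b - 1) (\<lambda>n. q powi (a - n) * f n)"
    unfolding wsum_pred_left wsum_pred_right wsum_add[symmetric] wsum_cmult[symmetric] * ..
  also have "wsum q a (b - 1) (\<lambda>n. q powi (a - n) * f n)
      = wsum q (a - 1) b (\<lambda>n. q powi (a - n - 1) * f (n + 1))"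
    by (subst wsum_shift) (simp add: algebra_simps)
  finally show ?thesis by (simp add: wsum_add)
qed

text \<open>The other q-Pascal rule, with the roles of the ends exchanged:
  \<open>1 - q^(a+b) = (1 - q^(b+n)) + q^(b+n) (1 - q^(a-n))\<close>.\<close>

lemma wsum_split_right:
  "(1 - q powi (a + b)) * wsum q a b f = wsum q (a - 1) b (\<lambda>n. f (n + 1) + q powi (b + n) * f n)"
proof -
  have *: "(1 - q powi (a + b)) * f n =
     (1 - q powi (b + n)) * f n + (1 - q powi (a - n)) * (q powi (b + n) * f n)" for n
    using qpow_add[of "b + n" "a - n"] by (simp add: algebra_simps)
  have "(1 - q powi (a + b)) * wsum q a b f
     = wsum q a (b - 1) f + wsum q (a - 1) b (\<lambda>n. q powi (b + n) * f n)"
    unfolding wsum_pred_left wsum_pred_right wsum_add[symmetric] wsum_cmult[symmetric] * ..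
  also have "wsum q a (b - 1) f = wsum q (a - 1) b (\<lambda>n. f (n + 1))"
    by (subst wsum_shift) simp
  finally show ?thesis by (simp add: wsum_add)
qed

section \<open>The innermost sum: a signed kernel sum, a one-sided sum, and their common
  recurrence\<close>

definition alpha :: "int \<Rightarrow> complex" where
  "alpha n = (-1) powi n * q powi (n\<^sup>2 - n)"

lemma alpha_succ: "alpha (n + 1) = - (q powi (2 * n) * alpha n)"
proof -
  have "q powi ((n + 1)\<^sup>2 - (n + 1)) = q powi (2 * n) * q powi (n\<^sup>2 - n)"
    unfolding qpow_add by (rule arg_cong[of _ _ "(powi) q"]) algebra
  then show ?thesis by (simp add: alpha_def minus_one_powi_shift)
qed

lemma alpha_reflect: "alpha (1 - n) = - alpha n"
proof -
  have "(-1::complex) powi (1 - n) = - ((-1) powi n)"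
    using minus_one_powi_shift(1)[of "- n"] minus_one_powi_shift(3)[of n] by (simp add: algebra_simps)
  moreover have "(1 - n)\<^sup>2 - (1 - n) = n\<^sup>2 - n" by algebra
  ultimately show ?thesis by (simp only: alpha_def) simp
qed

definition alpha_sum :: "int \<Rightarrow> int \<Rightarrow> complex" where
  "alpha_sum N m = wsum q N (N + m) alpha"

text \<open>Both q-Pascal rules send the sum at \<open>N + 1\<close> to the kernel with ends
  \<open>N\<close> and \<open>N + m + 1\<close>. On that kernel, \<open>alpha n\<close> gives
  \<open>alpha_sum N (m + 1)\<close> and \<open>alpha (n + 1)\<close> gives
  \<open>alpha_sum (N + 1) (m - 1)\<close>.\<close>

lemma alpha_sum_rec:
  "q powi (m + 1) * alpha_sum N (m + 1)
     = (1 + q powi (m + 1)) * (1 - q powi (2 * N + m + 2)) * alpha_sum (N + 1) m - alpha_sum (N + 1) (m - 1)"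
proof -
  let ?X = "q powi (m + 1)"
  have L: "(1 - q powi (2 * N + m + 2)) * alpha_sum (N + 1) m
      = wsum q N (N + m + 1) (\<lambda>n. alpha n + q powi (N - n) * alpha (n + 1))"
    using wsum_split_left[of "N + 1" "N + m + 1" alpha] by (simp add: alpha_sum_def algebra_simps)
  have R: "(1 - q powi (2 * N + m + 2)) * alpha_sum (N + 1) m
      = wsum q N (N + m + 1) (\<lambda>n. alpha (n + 1) + q powi (N + m + 1 + n) * alpha n)"
    using wsum_split_right[of "N + 1" "N + m + 1" alpha] by (simp add: alpha_sum_def algebra_simps)
  \<comment> \<open>Weighting the two splittings by \<open>q\<^bsup>m+1\<^esup>\<close> and \<open>1\<close> cancels the mixed terms.\<close>
  have *: "?X * (alpha n + q powi (N - n) * alpha (n + 1)) + (alpha (n + 1) + q powi (N + m + 1 + n) * alpha n)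
      = ?X * alpha n + alpha (n + 1)" for n
  proof -
    have "?X * (q powi (N - n) * alpha (n + 1)) = - (q powi (N + m + 1 + n) * alpha n)"
      unfolding alpha_succ by (simp add: qpow_add flip: mult.assoc) (simp add: algebra_simps)
    then show ?thesis by (simp add: ring_distribs)
  qed
  have "(1 + ?X) * (1 - q powi (2 * N + m + 2)) * alpha_sum (N + 1) m
     = ?X * ((1 - q powi (2 * N + m + 2)) * alpha_sum (N + 1) m) + (1 - q powi (2 * N + m + 2)) * alpha_sum (N + 1) m"
    by (simp add: algebra_simps)
  also have "\<dots> = wsum q N (N + m + 1) (\<lambda>n. ?X * alpha n + alpha (n + 1))"
    by (subst L, subst R) (simp only: wsum_add[symmetric] wsum_cmult[symmetric] *)
  also have "\<dots> = ?X * alpha_sum N (m + 1) + alpha_sum (N + 1) (m - 1)"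
    using wsum_shift[of q "N + 1" "N + m" alpha]
    by (simp only: wsum_add wsum_cmult) (simp add: alpha_sum_def algebra_simps)
  finally show ?thesis by simp
qed

text \<open>The reflection \<open>n -> 1 - n\<close> preserves the kernel with ends \<open>N\<close>
  and \<open>N - 1\<close> but negates \<open>alpha\<close>, so the sum equals its own
  negative.\<close>

lemma alpha_sum_minus_one: "alpha_sum N (- 1) = 0"
proof -
  have "alpha_sum N (- 1) = wsum q N (N - 1) (\<lambda>n. alpha (1 - n))"
    unfolding alpha_sum_def by (subst wsum_reflect[of _ _ _ _ 1]) simp
  also have "\<dots> = - alpha_sum N (- 1)"
    by (simp add: alpha_reflect wsum_uminus alpha_sum_def)
  finally show ?thesis by simp
qed

text \<open>With \<open>?A c\<close> for the sum weighted by \<open>q^(c n)\<close>, the two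
  splittings and the lowering of the right end give three linear relations. Once \<open>?A 2\<close>
  is known to vanish, \<open>?A 0\<close> and \<open>?A 1\<close> can be eliminated.\<close>

lemma alpha_sum_zero_rec: "(1 - q powi (2 * N)) * alpha_sum N 0 = q * alpha_sum (N - 1) 0"
proof -
  let ?A = "\<lambda>c. wsum q (N - 1) N (\<lambda>n. q powi (c * n) * alpha n)"
  \<comment> \<open>The weight \<open>q^(2n)\<close> turns \<open>alpha n\<close> into
    \<open>- alpha (n + 1)\<close>, so this is a shifted copy of the antisymmetric sum.\<close>
  have A2: "?A 2 = 0"
  proof -
    have "?A 2 = - wsum q (N - 1) N (\<lambda>n. alpha (n + 1))"
      by (simp add: alpha_succ wsum_uminus)
    also have "wsum q (N - 1) N (\<lambda>n. alpha (n + 1)) = alpha_sum N (- 1)"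
      using wsum_shift[of q N "N - 1" alpha] by (simp add: alpha_sum_def)
    finally show ?thesis by (simp add: alpha_sum_minus_one)
  qed
  have "(1 - q powi (2 * N)) * alpha_sum N 0 = wsum q (N - 1) N (\<lambda>n. alpha n + q powi (N - n - 1) * alpha (n + 1))"
    using wsum_split_left[of N N alpha] by (simp add: alpha_sum_def algebra_simps)
  also have "(\<lambda>n. alpha n + q powi (N - n - 1) * alpha (n + 1)) = (\<lambda>n. alpha n - q powi (N - 1) * (q powi (1 * n) * alpha n))"
  proof
    fix n
    have "q powi (N - n - 1) * alpha (n + 1) = - (q powi (N - 1) * (q powi (1 * n) * alpha n))"
      unfolding alpha_succ by (simp add: qpow_add flip: mult.assoc) (simp add: algebra_simps)
    then show "alpha n + q powi (N - n - 1) * alpha (n + 1) = alpha n - q powi (N - 1) * (q powi (1 * n) * alpha n)"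
      by simp
  qed
  finally have 1: "(1 - q powi (2 * N)) * alpha_sum N 0 = wsum q (N - 1) N alpha - q powi (N - 1) * ?A 1"
    by (simp only: wsum_diff wsum_cmult)
  have "(1 - q powi (2 * N)) * alpha_sum N 0 = wsum q (N - 1) N (\<lambda>n. alpha (n + 1) + q powi (N + n) * alpha n)"
    using wsum_split_right[of N N alpha] by (simp add: alpha_sum_def algebra_simps)
  also have "\<dots> = wsum q (N - 1) N (\<lambda>n. - (q powi (2 * n) * alpha n) + q powi N * (q powi (1 * n) * alpha n))"
    by (simp add: alpha_succ qpow_add flip: mult.assoc)
  also have "\<dots> = q powi N * ?A 1"
    by (simp only: wsum_add wsum_uminus wsum_cmult A2) simp
  finally have 2: "(1 - q powi (2 * N)) * alpha_sum N 0 = q powi N * ?A 1" .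
  have "alpha_sum (N - 1) 0 = wsum q (N - 1) N (\<lambda>n. alpha n - q powi N * (q powi (1 * n) * alpha n))"
    using wsum_pred_right[of "N - 1" N alpha]
    by (simp add: alpha_sum_def algebra_simps flip: qpow_add)
  then have 3: "alpha_sum (N - 1) 0 = wsum q (N - 1) N alpha - q powi N * ?A 1"
    by (simp only: wsum_diff wsum_cmult)
  have "q * q powi (N - 1) = q powi N"
    using qpow_add[of 1 "N - 1"] by simp
  with 1 2 3 show ?thesis
    by (metis (no_types, lifting) diff_add_cancel add_diff_cancel_left' mult.assoc add.commute)
qed

lemma alpha_sum_zero: "alpha_sum N 0 = q powi N * iqfact (q\<^sup>2) N"
proof -
  interpret q2: nome "q\<^sup>2" by (rule nome_power) simp
  have neg: "alpha_sum N 0 = 0" if "N < 0" for N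
  proof -
    have "iqfact q (N - n) * iqfact q (N + n) = 0" for n
      using that by (cases "n > N") auto
    then show ?thesis by (auto simp: alpha_sum_def wsum_def intro!: infsum_0)
  qed
  have zero: "alpha_sum 0 0 = 1"
    by (simp add: alpha_sum_def wsum_0_0 alpha_def)
  show ?thesis
  proof (cases "N < 0")
    case False
    then obtain k where "N = int k" by (metis not_less nonneg_int_cases)
    moreover have "alpha_sum (int k) 0 = q powi (int k) * iqfact (q\<^sup>2) (int k)"
    proof (induction k)
      case (Suc k)
      have nz: "1 - q powi (2 * int (Suc k)) \<noteq> 0"
        using powi_neq_1[of "2 * int (Suc k)"] by simp
      have "q\<^sup>2 powi int (Suc k) = q powi (2 * int (Suc k))"
        by (rule power2_powi)
      then have "(1 - q powi (2 * int (Suc k))) * iqfact (q\<^sup>2) (int (Suc k)) = iqfact (q\<^sup>2) (int k)"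
        using q2.iqfact_pred[of "int (Suc k)"] by simp
      then have "(1 - q powi (2 * int (Suc k))) * alpha_sum (int (Suc k)) 0
          = (1 - q powi (2 * int (Suc k))) * (q powi (int (Suc k)) * iqfact (q\<^sup>2) (int (Suc k)))"
        using alpha_sum_zero_rec[of "int (Suc k)"] Suc.IH qpow_add[of 1 "int k"]
        by (simp add: mult_ac add.commute)
      then show ?case using nz by simp
    qed (simp add: zero)
    ultimately show ?thesis by simp
  qed (simp add: neg)
qed

text \<open>This is \<open>(-q)_(m+2t)\<close> times the \<open>q^2\<close>-binomial of
  \<open>m + t\<close> over \<open>m + 2t\<close>, after cancelling \<open>(-q)_(m+2t)\<close>; see
  \<open>qpoch_qbinom_eq_beta_coeff\<close>. The reciprocal factors make it vanish unless
  \<open>-m <= 2t <= 0\<close>, which for \<open>m >= 0\<close> excludes every \<open>t\<close>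
  where \<open>nat\<close> truncates.\<close>

definition beta_coeff :: "int \<Rightarrow> int \<Rightarrow> complex" where
  "beta_coeff m t = qfact (q\<^sup>2) (nat (m + t)) * (iqfact (q\<^sup>2) (- t) * iqfact q (m + 2 * t))"

text \<open>The sum over the last variable \<open>t = s r\<close> with \<open>N = s (r - 1)\<close>
  held fixed, without the factor \<open>q^N\<close>.\<close>

definition beta_sum :: "int \<Rightarrow> int \<Rightarrow> complex" where
  "beta_sum N m = (\<Sum>\<^sub>\<infinity>t. (-1) powi t * q powi (t\<^sup>2 - 2 * t) * (beta_coeff m t * iqfact (q\<^sup>2) (N - t)))"

lemma beta_coeff_eq_0: "t < - \<bar>m\<bar> \<or> 0 < t \<Longrightarrow> beta_coeff m t = 0"
  by (auto simp: beta_coeff_def)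

text \<open>All four coefficients are rational functions of \<open>X = q^(m+1)\<close> and
  \<open>Y = q^(2t)\<close> times one common factor \<open>F * (a * d)\<close>, so the claim reduces
  to an identity in \<open>X\<close> and \<open>Y\<close>. Its shape is what comparing coefficients
  in \<open>beta_sum_rec\<close> demands.\<close>

lemma beta_coeff_rec:
  assumes "m \<ge> 0"
  shows "q powi (m + 1) * beta_coeff (m + 1) t =
    (1 + q powi (m + 1)) * (q powi (m + 2 * t + 1) * beta_coeff m t
       - q powi (2 * t) * ((1 - q powi (m + 2 * t + 2)) * beta_coeff m (t + 1)))
    + q powi (2 * t) * beta_coeff (m - 1) (t + 1)"
proof -
  interpret q2: nome "q\<^sup>2" by (rule nome_power) simp
  define X Y where "X = q powi (m + 1)" and "Y = q powi (2 * t)"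
  have Ynz: "Y \<noteq> 0" using q_nz by (simp add: Y_def)
  define F a d where "F = qfact (q\<^sup>2) (nat (m + t))" and "a = iqfact (q\<^sup>2) (- t)" and "d = iqfact q (m + 1 + 2 * t)"
  have XY: "q powi (m + 2 * t + 1) = X * Y"
    unfolding X_def Y_def qpow_add by (simp add: algebra_simps)
  have XXY: "q powi (2 * (m + t + 1)) = X * X * Y"
    unfolding X_def Y_def qpow_add by (simp add: algebra_simps)
  have Yi: "q powi (- (2 * t)) = 1 / Y"
    by (simp add: Y_def power_int_minus divide_simps)
  \<comment> \<open>For \<open>m + t < 0\<close> the truncation by \<open>nat\<close> breaks the
    factorial recurrence, but then \<open>t > 0\<close> kills \<open>a\<close>, and otherwise
    \<open>m + 1 + 2t < 0\<close> kills \<open>d\<close>.\<close>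
  have qf: "qfact (q\<^sup>2) (nat (m + 1 + t)) * (a * d) = (1 - X * X * Y) * F * (a * d)"
  proof (cases "m + t \<ge> 0")
    case True
    then have "nat (m + 1 + t) = Suc (nat (m + t))" by linarith
    moreover have "(q\<^sup>2) ^ Suc (nat (m + t)) = q powi (2 * (m + t + 1))"
      using True power2_powi[of q "m + t + 1"] by (simp add: powi_nonneg nat_add_distrib)
    ultimately show ?thesis by (simp only: qfact_Suc F_def XXY) (simp add: mult_ac)
  next
    case False
    then have "a * d = 0" using assms by (cases "t > 0") (auto simp: a_def d_def)
    then show ?thesis by simp
  qed
  have im: "iqfact (q\<^sup>2) (- (t + 1)) = (1 - 1 / Y) * a"
    using q2.iqfact_pred[of "- t"] by (simp add: a_def power2_powi Yi)
  have c1: "beta_coeff (m + 1) t = (1 - X * X * Y) * F * (a * d)"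
    using qf by (simp add: beta_coeff_def a_def d_def)
  have c2: "beta_coeff m t = (1 - X * Y) * F * (a * d)"
    using iqfact_succ[of "m + 2 * t"] unfolding XY by (simp add: beta_coeff_def a_def d_def F_def add_ac mult_ac)
  have "(1 - q powi (m + 2 * t + 2)) * iqfact q (m + 2 * (t + 1)) = d"
    using iqfact_pred[of "m + 2 * (t + 1)"] by (simp add: d_def algebra_simps)
  then have "(1 - q powi (m + 2 * t + 2)) * beta_coeff m (t + 1) = (1 - 1 / Y) * (qfact (q\<^sup>2) (nat (m + 1 + t)) * (a * d))"
    unfolding beta_coeff_def im by (simp add: add_ac mult_ac)
  then have c3: "(1 - q powi (m + 2 * t + 2)) * beta_coeff m (t + 1) = (1 - 1 / Y) * ((1 - X * X * Y) * F * (a * d))"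
    unfolding qf .
  have c4: "beta_coeff (m - 1) (t + 1) = (1 - 1 / Y) * F * (a * d)"
    unfolding beta_coeff_def im by (simp add: F_def d_def algebra_simps)
  show ?thesis
    unfolding c1 c2 c3 c4 XY X_def[symmetric] Y_def[symmetric] using Ynz
    by (simp add: field_simps)
qed

text \<open>The recurrence of \<open>alpha_sum_rec\<close> for \<open>q^N * beta_sum N m\<close>;
  the extra factors \<open>q\<close> come from \<open>q^(N+1) = q * q^N\<close>. Every term is
  rewritten as a sum against \<open>iqfact (q^2) (N - t)\<close>, and then coefficients are
  compared.\<close>

lemma beta_sum_rec:
  assumes "m \<ge> 0"
  shows "q powi (m + 1) * beta_sum N (m + 1)
    = (1 + q powi (m + 1)) * (1 - q powi (2 * N + m + 2)) * (q * beta_sum (N + 1) m) - q * beta_sum (N + 1) (m - 1)"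
proof -
  interpret q2: nome "q\<^sup>2" by (rule nome_power) simp
  define w where "w t = (-1) powi t * q powi (t\<^sup>2 - 2 * t)" for t
  have w_succ: "q * w (t + 1) = - (q powi (2 * t) * w t)" for t
  proof -
    have "q * q powi ((t + 1)\<^sup>2 - 2 * (t + 1)) = q powi (1 + ((t + 1)\<^sup>2 - 2 * (t + 1)))"
      by (simp only: qpow_add[symmetric]) simp
    also have "1 + ((t + 1)\<^sup>2 - 2 * (t + 1)) = 2 * t + (t\<^sup>2 - 2 * t)" by algebra
    finally show ?thesis by (simp add: w_def minus_one_powi_shift qpow_add mult_ac)
  qed
  have summ: "(\<lambda>t. beta_coeff k t * f t) summable_on UNIV" for k f
    by (rule summable_on_zero_outside[of "- \<bar>k\<bar>" 0]) (simp add: beta_coeff_eq_0)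
  have summ1: "(\<lambda>t. beta_coeff k (t + 1) * f t) summable_on UNIV" for k f
    by (rule summable_on_zero_outside[of "- \<bar>k\<bar> - 1" 0]) (subst beta_coeff_eq_0, auto)
  have r: "beta_sum N k = (\<Sum>\<^sub>\<infinity>t. beta_coeff k t * (w t * iqfact (q\<^sup>2) (N - t)))" for N k
    by (simp add: beta_sum_def w_def mult_ac)
  have r1: "q * beta_sum (N + 1) k = (\<Sum>\<^sub>\<infinity>t. beta_coeff k (t + 1) * (- (q powi (2 * t) * w t) * iqfact (q\<^sup>2) (N - t)))" for k
    unfolding r w_succ[symmetric]
    by (subst infsum_shift[of _ 1, symmetric], subst infsum_cmult_right'[symmetric]) (simp add: mult_ac)
  \<comment> \<open>The prefactor is split as
    \<open>(1 - q^(m+2t)) + q^(m+2t) (1 - q^(2(N+1-t)))\<close>. The second piece lowers the index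
    to \<open>N - t\<close> at once; the first reaches it after the shift
    \<open>t -> t + 1\<close>.\<close>
  have *: "(1 - q powi (2 * N + m + 2)) * iqfact (q\<^sup>2) (N + 1 - t)
     = (1 - q powi (m + 2 * t)) * iqfact (q\<^sup>2) (N + 1 - t) + q powi (m + 2 * t) * iqfact (q\<^sup>2) (N - t)" for t
  proof -
    have "iqfact (q\<^sup>2) (N - t) = (1 - q powi (2 * (N + 1 - t))) * iqfact (q\<^sup>2) (N + 1 - t)"
      using q2.iqfact_pred[of "N + 1 - t"] unfolding power2_powi by (simp add: algebra_simps)
    moreover have "q powi (m + 2 * t) * q powi (2 * (N + 1 - t)) = q powi (2 * N + m + 2)"
      unfolding qpow_add by (simp add: algebra_simps)
    ultimately show ?thesis by algebra
  qed
  have "(1 - q powi (2 * N + m + 2)) * beta_sum (N + 1) m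
     = (\<Sum>\<^sub>\<infinity>t. beta_coeff m t * (w t * ((1 - q powi (m + 2 * t)) * iqfact (q\<^sup>2) (N + 1 - t)))
           + beta_coeff m t * (w t * (q powi (m + 2 * t) * iqfact (q\<^sup>2) (N - t))))"
    unfolding r
  proof (subst infsum_cmult_right'[symmetric], rule infsum_cong)
    fix t
    show "(1 - q powi (2 * N + m + 2)) * (beta_coeff m t * (w t * iqfact (q\<^sup>2) (N + 1 - t)))
      = beta_coeff m t * (w t * ((1 - q powi (m + 2 * t)) * iqfact (q\<^sup>2) (N + 1 - t)))
         + beta_coeff m t * (w t * (q powi (m + 2 * t) * iqfact (q\<^sup>2) (N - t)))"
      using *[of t] by algebra
  qed
  also have "\<dots> = (\<Sum>\<^sub>\<infinity>t. beta_coeff m t * (w t * ((1 - q powi (m + 2 * t)) * iqfact (q\<^sup>2) (N + 1 - t))))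
     + (\<Sum>\<^sub>\<infinity>t. beta_coeff m t * (w t * (q powi (m + 2 * t) * iqfact (q\<^sup>2) (N - t))))"
    by (rule infsum_add) (rule summ)+
  also have "(\<Sum>\<^sub>\<infinity>t. beta_coeff m t * (w t * ((1 - q powi (m + 2 * t)) * iqfact (q\<^sup>2) (N + 1 - t))))
     = (\<Sum>\<^sub>\<infinity>t. beta_coeff m (t + 1) * (w (t + 1) * ((1 - q powi (m + 2 * t + 2)) * iqfact (q\<^sup>2) (N - t))))"
    by (subst infsum_shift[of _ 1, symmetric]) (simp add: algebra_simps)
  finally have "(1 - q powi (2 * N + m + 2)) * (q * beta_sum (N + 1) m)
     = q * ((\<Sum>\<^sub>\<infinity>t. beta_coeff m (t + 1) * (w (t + 1) * ((1 - q powi (m + 2 * t + 2)) * iqfact (q\<^sup>2) (N - t))))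
     + (\<Sum>\<^sub>\<infinity>t. beta_coeff m t * (w t * (q powi (m + 2 * t) * iqfact (q\<^sup>2) (N - t)))))"
    by (simp add: mult_ac)
  also have "\<dots> = (\<Sum>\<^sub>\<infinity>t. beta_coeff m (t + 1) * (- (q powi (2 * t) * w t) * ((1 - q powi (m + 2 * t + 2)) * iqfact (q\<^sup>2) (N - t))))
     + (\<Sum>\<^sub>\<infinity>t. beta_coeff m t * (w t * (q powi (m + 2 * t + 1) * iqfact (q\<^sup>2) (N - t))))"
  proof -
    have "q powi (m + 2 * t + 1) = q * q powi (m + 2 * t)" for t
      using qpow_add[of 1 "m + 2 * t"] by (simp add: add_ac)
    then show ?thesis
      unfolding w_succ[symmetric] ring_distribs infsum_cmult_right'[symmetric] by (simp add: mult_ac)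
  qed
  finally have eq: "(1 - q powi (2 * N + m + 2)) * (q * beta_sum (N + 1) m) = 
     (\<Sum>\<^sub>\<infinity>t. beta_coeff m (t + 1) * (- (q powi (2 * t) * w t) * ((1 - q powi (m + 2 * t + 2)) * iqfact (q\<^sup>2) (N - t)))
        + beta_coeff m t * (w t * (q powi (m + 2 * t + 1) * iqfact (q\<^sup>2) (N - t))))" (is "_ = infsum ?f _")
    by (simp only: infsum_add[OF summ1 summ])
  have fs: "?f summable_on UNIV"
    by (intro summable_on_add summ summ1)
  have r2: "- (q * beta_sum (N + 1) (m - 1)) = (\<Sum>\<^sub>\<infinity>t. beta_coeff (m - 1) (t + 1) * (q powi (2 * t) * w t * iqfact (q\<^sup>2) (N - t)))"
    unfolding r1 infsum_uminus[symmetric] by simp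
  have "q powi (m + 1) * beta_sum N (m + 1)
     = (\<Sum>\<^sub>\<infinity>t. (1 + q powi (m + 1)) * ?f t + beta_coeff (m - 1) (t + 1) * (q powi (2 * t) * w t * iqfact (q\<^sup>2) (N - t)))"
    unfolding r
  proof (subst infsum_cmult_right'[symmetric], rule infsum_cong)
    fix t
    have "q powi (m + 1) * (beta_coeff (m + 1) t * (w t * iqfact (q\<^sup>2) (N - t)))
       = (q powi (m + 1) * beta_coeff (m + 1) t) * (w t * iqfact (q\<^sup>2) (N - t))" by simp
    also have "\<dots> = (1 + q powi (m + 1)) * ?f t + beta_coeff (m - 1) (t + 1) * (q powi (2 * t) * w t * iqfact (q\<^sup>2) (N - t))"
      unfolding beta_coeff_rec[OF assms] by algebra
    finally show "q powi (m + 1) * (beta_coeff (m + 1) t * (w t * iqfact (q\<^sup>2) (N - t))) = \<dots>" .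
  qed
  also have "\<dots> = (1 + q powi (m + 1)) * infsum ?f UNIV + - (q * beta_sum (N + 1) (m - 1))"
    unfolding r2 infsum_cmult_right'[symmetric]
    by (rule infsum_add[OF summable_on_cmult_right[OF fs] summ1])
  finally show ?thesis unfolding eq[symmetric] by (simp add: mult.assoc)
qed

lemma beta_sum_zero: "beta_sum N 0 = iqfact (q\<^sup>2) N"
proof -
  have "beta_sum N 0 = (\<Sum>\<^sub>\<infinity>t\<in>{0}. (-1) powi t * q powi (t\<^sup>2 - 2 * t) * (beta_coeff 0 t * iqfact (q\<^sup>2) (N - t)))"
    unfolding beta_sum_def by (rule infsum_cong_neutral) (auto simp: neq_iff beta_coeff_eq_0)
  then show ?thesis by (simp add: beta_coeff_def)
qed

lemma beta_sum_minus_one: "beta_sum N (- 1) = 0"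
proof -
  have "beta_coeff (- 1) t = 0" for t
    by (cases "t \<le> 0") (auto simp: beta_coeff_def)
  then show ?thesis by (simp add: beta_sum_def)
qed

text \<open>Two solutions of one three-term recurrence in \<open>m\<close> that agree at -1 and 0.
  The offset \<open>int m - 1\<close> starts the induction at -1, and \<open>N\<close> stays
  arbitrary because the recurrence refers to \<open>N + 1\<close>.\<close>

lemma alpha_sum_eq_beta_sum: "alpha_sum N (int m - 1) = q powi N * beta_sum N (int m - 1)"
proof (induction m arbitrary: N rule: induct_nat_012)
  case (ge2 m)
  have "q powi (N + 1) = q powi N * q"
    using qpow_add[of N 1] by simp
  moreover have "alpha_sum (N + 1) (int m - 1) = q powi (N + 1) * beta_sum (N + 1) (int m - 1)"
    "alpha_sum (N + 1) (int m) = q powi (N + 1) * beta_sum (N + 1) (int m)"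
    using ge2[of "N + 1"] by simp_all
  ultimately have "q powi (int m + 1) * alpha_sum N (int m + 1) = q powi (int m + 1) * (q powi N * beta_sum N (int m + 1))"
    using alpha_sum_rec[of "int m" N] beta_sum_rec[of "int m" N, OF of_nat_0_le_iff] by algebra
  then show ?case using q_nz by (simp add: add.commute)
qed (simp_all add: alpha_sum_minus_one beta_sum_minus_one alpha_sum_zero beta_sum_zero)

section \<open>The q-Vandermonde sum and a variant with shifted exponent\<close>

lemma q_vandermonde_aux:
  "(\<Sum>\<^sub>\<infinity>j. q powi (j\<^sup>2 + b * j) * (iqfact q (L - j) * (iqfact q j * iqfact q (j + b)))) = iqfact q L * iqfact q (L + b)"
proof -
  define S where "S L b = (\<Sum>\<^sub>\<infinity>j. q powi (j\<^sup>2 + b * j) * (iqfact q (L - j) * (iqfact q j * iqfact q (j + b))))" for L b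
  have summ: "(\<lambda>j. f j * (iqfact q (L - j) * (iqfact q j * g j))) summable_on UNIV" for f g L
    by (rule summable_on_zero_outside[of 0 L]) auto
  \<comment> \<open>This trades a unit of \<open>L\<close> for a unit of \<open>b\<close>, so
    induction on \<open>L\<close> with \<open>b\<close> arbitrary suffices. From
    \<open>1 - q^L = (1 - q^j) + q^j (1 - q^(L-j))\<close> two sums arise; after a shift in the
    first, they merge by the recurrence of \<open>iqfact\<close> at
    \<open>j + b + 1\<close>.\<close>
  have rec: "(1 - q powi L) * S L b = S (L - 1) (b + 1)" for L b
  proof -
    have split: "(1 - q powi L) * (iqfact q (L - j) * iqfact q j)
      = iqfact q (L - j) * iqfact q (j - 1) + q powi j * (iqfact q (L - 1 - j) * iqfact q j)" for j
    proof -
      have "iqfact q (L - 1 - j) = (1 - q powi (L - j)) * iqfact q (L - j)"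
        using iqfact_pred[of "L - j"] by (simp add: algebra_simps)
      moreover have "q powi L = q powi j * q powi (L - j)"
        by (simp add: qpow_add)
      ultimately show ?thesis using iqfact_pred[of j] by algebra
    qed
    have e: "q powi (j\<^sup>2 + b * j) * q powi j = q powi (j\<^sup>2 + (b + 1) * j)" for j
      unfolding qpow_add by (simp add: algebra_simps)
    have e1: "q powi ((j + 1)\<^sup>2 + b * (j + 1)) = q powi (j\<^sup>2 + (b + 1) * j) * q powi (j + b + 1)" for j
      unfolding qpow_add by (rule arg_cong[of _ _ "(powi) q"]) algebra
    have "(1 - q powi L) * S L b = (\<Sum>\<^sub>\<infinity>j. q powi (j\<^sup>2 + b * j) * (iqfact q (j - 1) * (iqfact q (L - j) * iqfact q (j + b)))
        + q powi (j\<^sup>2 + (b + 1) * j) * (iqfact q (L - 1 - j) * (iqfact q j * iqfact q (j + b))))"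
      unfolding S_def
    proof (subst infsum_cmult_right'[symmetric], rule infsum_cong)
      fix j
      have "(1 - q powi L) * (q powi (j\<^sup>2 + b * j) * (iqfact q (L - j) * (iqfact q j * iqfact q (j + b))))
        = ((1 - q powi L) * (iqfact q (L - j) * iqfact q j)) * (q powi (j\<^sup>2 + b * j) * iqfact q (j + b))" by simp
      also have "\<dots> = q powi (j\<^sup>2 + b * j) * (iqfact q (j - 1) * (iqfact q (L - j) * iqfact q (j + b)))
        + q powi (j\<^sup>2 + (b + 1) * j) * (iqfact q (L - 1 - j) * (iqfact q j * iqfact q (j + b)))"
        unfolding split e[symmetric] by algebra
      finally show "(1 - q powi L) * (q powi (j\<^sup>2 + b * j) * (iqfact q (L - j) * (iqfact q j * iqfact q (j + b)))) = \<dots>" .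
    qed
    also have "\<dots> = (\<Sum>\<^sub>\<infinity>j. q powi (j\<^sup>2 + b * j) * (iqfact q (j - 1) * (iqfact q (L - j) * iqfact q (j + b))))
        + (\<Sum>\<^sub>\<infinity>j. q powi (j\<^sup>2 + (b + 1) * j) * (iqfact q (L - 1 - j) * (iqfact q j * iqfact q (j + b))))"
      by (rule infsum_add[OF _ summ], rule summable_on_zero_outside[of 0 L]) auto
    also have "(\<Sum>\<^sub>\<infinity>j. q powi (j\<^sup>2 + b * j) * (iqfact q (j - 1) * (iqfact q (L - j) * iqfact q (j + b))))
       = (\<Sum>\<^sub>\<infinity>j. q powi (j\<^sup>2 + (b + 1) * j) * (iqfact q (L - 1 - j) * (iqfact q j * (q powi (j + b + 1) * iqfact q (j + b + 1)))))"
      by (subst infsum_shift[of _ 1, symmetric], rule infsum_cong, subst e1) (simp add: algebra_simps)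
    also have "\<dots> + (\<Sum>\<^sub>\<infinity>j. q powi (j\<^sup>2 + (b + 1) * j) * (iqfact q (L - 1 - j) * (iqfact q j * iqfact q (j + b))))
       = S (L - 1) (b + 1)"
      unfolding S_def
    proof (subst infsum_add[OF summ summ, symmetric], rule infsum_cong)
      fix j
      show "q powi (j\<^sup>2 + (b + 1) * j) * (iqfact q (L - 1 - j) * (iqfact q j * (q powi (j + b + 1) * iqfact q (j + b + 1))))
         + q powi (j\<^sup>2 + (b + 1) * j) * (iqfact q (L - 1 - j) * (iqfact q j * iqfact q (j + b)))
         = q powi (j\<^sup>2 + (b + 1) * j) * (iqfact q (L - 1 - j) * (iqfact q j * iqfact q (j + (b + 1))))"
        using iqfact_succ[of "j + b"] by (simp add: ring_distribs add.assoc)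
    qed
    finally show ?thesis .
  qed
  have "S (int l) b = iqfact q (int l) * iqfact q (int l + b)" for l b
  proof (induction l arbitrary: b)
    case 0
    have "S 0 b = (\<Sum>\<^sub>\<infinity>j\<in>{0}. q powi (j\<^sup>2 + b * j) * (iqfact q (0 - j) * (iqfact q j * iqfact q (j + b))))"
      unfolding S_def by (rule infsum_cong_neutral) (auto simp: neq_iff)
    then show ?case by simp
  next
    case (Suc l)
    have nz: "1 - q powi int (Suc l) \<noteq> 0"
      using powi_neq_1[of "int (Suc l)"] by simp
    have "(1 - q powi int (Suc l)) * S (int (Suc l)) b = iqfact q (int l) * iqfact q (int l + (b + 1))"
      unfolding rec by (simp add: Suc.IH)
    also have "\<dots> = (1 - q powi int (Suc l)) * (iqfact q (int (Suc l)) * iqfact q (int (Suc l) + b))"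
      using iqfact_pred[of "int (Suc l)"] by (simp add: add_ac)
    finally show ?case using nz by simp
  qed
  moreover have "S L b = 0" if "L < 0"
  proof -
    have "iqfact q (L - j) * (iqfact q j * iqfact q (j + b)) = 0" for j
      using that by (cases "j < 0") auto
    then show ?thesis unfolding S_def by (auto intro!: infsum_0)
  qed
  ultimately show ?thesis
    unfolding S_def[symmetric] by (cases "L < 0") (auto, metis not_less nonneg_int_cases)
qed

text \<open>The substitution \<open>N = j + n\<close> reduces this to the previous sum with
  \<open>b = c + 2n\<close>. In Bailey terms, the kernel in \<open>N\<close> is reproduced as the
  kernel in \<open>M\<close>.\<close>

lemma q_vandermonde:
  "(\<Sum>\<^sub>\<infinity>N. q powi (N\<^sup>2 + c * N) * (iqfact q (M - N) * (iqfact q (N - n) * iqfact q (N + c + n))))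
     = q powi (n\<^sup>2 + c * n) * (iqfact q (M - n) * iqfact q (M + c + n))"
proof -
  have e: "q powi ((j + n)\<^sup>2 + c * (j + n)) = q powi (n\<^sup>2 + c * n) * q powi (j\<^sup>2 + (c + 2 * n) * j)" for j
    unfolding qpow_add by (rule arg_cong[of _ _ "(powi) q"]) algebra
  have "(\<Sum>\<^sub>\<infinity>N. q powi (N\<^sup>2 + c * N) * (iqfact q (M - N) * (iqfact q (N - n) * iqfact q (N + c + n))))
     = q powi (n\<^sup>2 + c * n) * (\<Sum>\<^sub>\<infinity>j. q powi (j\<^sup>2 + (c + 2 * n) * j) * (iqfact q (M - n - j) * (iqfact q j * iqfact q (j + (c + 2 * n)))))"
    by (subst infsum_shift[of _ n, symmetric], subst infsum_cmult_right'[symmetric], rule infsum_cong, subst e)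
       (simp add: algebra_simps)
  then show ?thesis
    unfolding q_vandermonde_aux by (simp add: algebra_simps)
qed

text \<open>Inserting \<open>1 = (1 - q^(N-n)) + q^(N-n)\<close> leaves two ordinary q-Vandermonde
  sums: the first bracket moves \<open>(n, c)\<close> to \<open>(n + 1, c - 1)\<close>, and the
  second restores the exponent \<open>N^2 + c N\<close>.\<close>

lemma q_vandermonde_shifted:
  "(\<Sum>\<^sub>\<infinity>N. q powi (N\<^sup>2 + (c - 1) * N) * (iqfact q (M - N) * (iqfact q (N - n) * iqfact q (N + c + n))))
     = q powi (n\<^sup>2 + (c - 1) * n) * (iqfact q (M - n) * iqfact q (M + c + n))
         * (1 + q powi (c + 2 * n) - q powi (M + c + n))"
proof -
  have summ: "(\<lambda>N. f N * (iqfact q (M - N) * (iqfact q (N - k) * g N))) summable_on UNIV" for f g k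
    by (rule summable_on_zero_outside[of k M]) auto
  have e: "q powi (N\<^sup>2 + (c - 1) * N) * q powi (N - n) = q powi (- n) * q powi (N\<^sup>2 + c * N)" for N
    unfolding qpow_add by (simp add: algebra_simps)
  have "(\<Sum>\<^sub>\<infinity>N. q powi (N\<^sup>2 + (c - 1) * N) * (iqfact q (M - N) * (iqfact q (N - n) * iqfact q (N + c + n))))
     = (\<Sum>\<^sub>\<infinity>N. q powi (N\<^sup>2 + (c - 1) * N) * (iqfact q (M - N) * (iqfact q (N - (n + 1)) * iqfact q (N + (c - 1) + (n + 1))))
          + q powi (- n) * (q powi (N\<^sup>2 + c * N) * (iqfact q (M - N) * (iqfact q (N - n) * iqfact q (N + c + n)))))"
  proof (rule infsum_cong)
    fix N
    have i: "iqfact q (N - (n + 1)) = (1 - q powi (N - n)) * iqfact q (N - n)"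
      using iqfact_pred[of "N - n"] by (simp add: algebra_simps)
    have a: "N + (c - 1) + (n + 1) = N + c + n" by simp
    show "q powi (N\<^sup>2 + (c - 1) * N) * (iqfact q (M - N) * (iqfact q (N - n) * iqfact q (N + c + n)))
     = q powi (N\<^sup>2 + (c - 1) * N) * (iqfact q (M - N) * (iqfact q (N - (n + 1)) * iqfact q (N + (c - 1) + (n + 1))))
          + q powi (- n) * (q powi (N\<^sup>2 + c * N) * (iqfact q (M - N) * (iqfact q (N - n) * iqfact q (N + c + n))))"
      unfolding mult.assoc[symmetric] e[symmetric] unfolding i a by algebra
  qed
  also have "\<dots> = q powi ((n + 1)\<^sup>2 + (c - 1) * (n + 1)) * (iqfact q (M - (n + 1)) * iqfact q (M + (c - 1) + (n + 1)))
      + q powi (- n) * (q powi (n\<^sup>2 + c * n) * (iqfact q (M - n) * iqfact q (M + c + n)))"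
    unfolding q_vandermonde[symmetric] infsum_cmult_right'[symmetric]
    by (rule infsum_add[OF summ summable_on_cmult_right[OF summ]])
  also have "\<dots> = q powi (n\<^sup>2 + (c - 1) * n) * (iqfact q (M - n) * iqfact q (M + c + n))
         * (1 + q powi (c + 2 * n) - q powi (M + c + n))"
  proof -
    have i: "iqfact q (M - (n + 1)) = (1 - q powi (M - n)) * iqfact q (M - n)"
      using iqfact_pred[of "M - n"] by (simp add: algebra_simps)
    have a: "M + (c - 1) + (n + 1) = M + c + n" by simp
    have e1: "q powi ((n + 1)\<^sup>2 + (c - 1) * (n + 1)) = q powi (n\<^sup>2 + (c - 1) * n) * q powi (c + 2 * n)"
      unfolding qpow_add by (rule arg_cong[of _ _ "(powi) q"]) algebra
    have e2: "q powi (- n) * q powi (n\<^sup>2 + c * n) = q powi (n\<^sup>2 + (c - 1) * n)"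
      unfolding qpow_add by (simp add: algebra_simps)
    have e3: "q powi (M + c + n) = q powi (c + 2 * n) * q powi (M - n)"
      unfolding qpow_add by (simp add: algebra_simps)
    show ?thesis unfolding mult.assoc[symmetric] e2 e3 e1 i a by algebra
  qed
  finally show ?thesis .
qed

end

subsection \<open>Limits and the Jacobi triple product\<close>

text \<open>Dominated convergence for the counting measure, restated for
  \<open>infsum\<close>.\<close>

lemma tannery:
  fixes s :: "nat \<Rightarrow> 'a \<Rightarrow> complex" and w :: "'a \<Rightarrow> real"
  assumes w: "w summable_on A"
    and lim: "\<And>x. x \<in> A \<Longrightarrow> (\<lambda>i. s i x) \<longlonglongrightarrow> f x"
    and bound: "\<And>i x. x \<in> A \<Longrightarrow> norm (s i x) \<le> w x"
  shows "(\<lambda>i. infsum (s i) A) \<longlonglongrightarrow> infsum f A"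
proof -
  have conv: "infsum g A = integral\<^sup>L (count_space A) g" if "integrable (count_space A) g" for g :: "'a \<Rightarrow> complex"
    using infsetsum_infsum[of g A] that by (simp add: abs_summable_on_def infsetsum_def)
  have "(\<lambda>x. norm (w x)) summable_on A"
    using w by (rule summable_on_iff_abs_summable_on_real[THEN iffD1])
  then have "integrable (count_space A) w"
    by (simp only: abs_summable_equivalent abs_summable_on_def)
  note dom = _ _ this AE_I2 AE_I2
  have "integrable (count_space A) f"
    by (rule integrable_dominated_convergence[OF dom, where s = s]) (use lim bound in auto)
  moreover have "integrable (count_space A) (s i)" for i
    by (rule integrable_dominated_convergence2[OF dom, where f = f]) (use lim bound in auto)
  moreover have "(\<lambda>i. integral\<^sup>L (count_space A) (s i)) \<longlonglongrightarrow> integral\<^sup>L (count_space A) f"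
    by (rule integral_dominated_convergence[OF dom]) (use lim bound in auto)
  ultimately show ?thesis by (simp add: conv)
qed

section \<open>Infinite q-Pochhammer products\<close>

lemma qpoch_inf_convergent:
  fixes p x :: complex
  assumes "norm p < 1"
  shows "convergent_prod (\<lambda>j. 1 - x * p ^ j)"
proof -
  have "summable (\<lambda>j. norm x * norm p ^ j)"
    using assms by (intro summable_mult summable_geometric) simp
  then have "abs_convergent_prod (\<lambda>j. 1 - x * p ^ j)"
    by (intro summable_imp_abs_convergent_prod) (simp add: norm_mult norm_power)
  then show ?thesis by (rule abs_convergent_prod_imp_convergent_prod)
qed

lemma qpoch_inf_LIMSEQ:
  assumes "norm p < 1"
  shows "(\<lambda>n. \<Prod>j<n. 1 - x * p ^ j) \<longlonglongrightarrow> qpoch_inf x p"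
proof -
  have "(\<lambda>n. \<Prod>j\<le>n. 1 - x * p ^ j) \<longlonglongrightarrow> qpoch_inf x p"
    unfolding qpoch_inf_def by (rule convergent_prod_LIMSEQ[OF qpoch_inf_convergent[OF assms]])
  then have "(\<lambda>n. \<Prod>j<Suc n. 1 - x * p ^ j) \<longlonglongrightarrow> qpoch_inf x p"
    by (simp only: lessThan_Suc_atMost)
  then show ?thesis by (rule LIMSEQ_imp_Suc)
qed

lemma qpoch_inf_split:
  assumes "norm p < 1"
  shows "qpoch_inf x p = (\<Prod>j<k. 1 - x * p ^ j) * qpoch_inf (x * p ^ k) p"
proof (rule LIMSEQ_unique)
  show "(\<lambda>n. \<Prod>j<n + k. 1 - x * p ^ j) \<longlonglongrightarrow> qpoch_inf x p"
    by (rule LIMSEQ_ignore_initial_segment[OF qpoch_inf_LIMSEQ[OF assms]])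
  have "(\<Prod>j<n + k. 1 - x * p ^ j) = (\<Prod>j<k. 1 - x * p ^ j) * (\<Prod>j<n. 1 - (x * p ^ k) * p ^ j)" for n
    by (induction n) (simp_all add: power_add mult_ac)
  then show "(\<lambda>n. \<Prod>j<n + k. 1 - x * p ^ j) \<longlonglongrightarrow> (\<Prod>j<k. 1 - x * p ^ j) * qpoch_inf (x * p ^ k) p"
    by (simp only:) (intro tendsto_intros qpoch_inf_LIMSEQ assms)
qed

lemma qpoch_inf_nz:
  assumes "norm p < 1" "norm x < 1"
  shows "qpoch_inf x p \<noteq> 0"
proof -
  have "1 - x * p ^ j \<noteq> 0" for j
  proof
    assume "1 - x * p ^ j = 0"
    then have "norm x * norm p ^ j = 1"
      by (metis eq_iff_diff_eq_0 norm_mult norm_one norm_power)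
    moreover have "norm x * norm p ^ j \<le> norm x * 1"
      using assms by (intro mult_left_mono power_le_one) auto
    ultimately show False using assms by simp
  qed
  then show ?thesis
    unfolding qpoch_inf_def by (intro prodinf_nonzero qpoch_inf_convergent assms)
qed

text \<open>Since \<open>qpoch\<close> is a quotient of infinite products, its finite form requires
  a nonzero denominator, which \<open>norm x < 1\<close> supplies.\<close>

lemma qpoch_nonneg:
  assumes "norm p < 1" "norm x < 1" "k \<ge> 0"
  shows "qpoch x p k = (\<Prod>j<nat k. 1 - x * p ^ j)"
proof -
  have "norm (x * p ^ nat k) \<le> norm x * 1"
    unfolding norm_mult norm_power using assms by (intro mult_left_mono power_le_one) auto
  then have "qpoch_inf (x * p ^ nat k) p \<noteq> 0"
    using assms by (intro qpoch_inf_nz) auto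
  then show ?thesis
    using assms qpoch_inf_split[of p x "nat k"] by (simp add: qpoch_def powi_nonneg)
qed

section \<open>Summability of theta series and the Jacobi triple product\<close>

context nome
begin

lemma powi_quadratic_summable:
  assumes "d > 0"
  shows "(\<lambda>n::int. norm (q powi (d * n\<^sup>2 + c * n))) summable_on UNIV"
proof -
  define \<rho> where "\<rho> = norm q"
  have \<rho>: "0 < \<rho>" "\<rho> < 1" using norm_q q_nz by (auto simp: \<rho>_def)
  \<comment> \<open>Completing the square, \<open>(2|n| - (|c|+1))^2 >= 0\<close> gives
    \<open>(|c|+1)|n| <= n^2 + K\<close>. Hence the exponent is at least \<open>|n| - K\<close>, and
    a two-sided geometric series dominates.\<close>
  define K where "K = (\<bar>c\<bar> + 1)\<^sup>2"
  have geo: "(\<lambda>k. \<rho> ^ k) summable_on (UNIV :: nat set)"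
    using \<rho> by (intro summable_nonneg_imp_summable_on) (auto intro: summable_geometric)
  have pos: "(\<lambda>n::int. \<rho> ^ nat \<bar>n\<bar>) summable_on {0..}"
    using geo by (subst summable_on_reindex_bij_witness[of _ int nat UNIV "\<lambda>k. \<rho> ^ k"]) auto
  have neg: "(\<lambda>n::int. \<rho> ^ nat \<bar>n\<bar>) summable_on {..0}"
    using geo by (subst summable_on_reindex_bij_witness[of _ "\<lambda>k. - int k" "\<lambda>n. nat (- n)" UNIV "\<lambda>k. \<rho> ^ k"]) auto
  have "(\<lambda>n::int. \<rho> ^ nat \<bar>n\<bar>) summable_on {0..} \<union> {..0}"
    using pos neg by (rule summable_on_union)
  moreover have "{0..} \<union> {..0} = (UNIV :: int set)" by auto
  ultimately have "(\<lambda>n::int. \<rho> powi (- K) * \<rho> ^ nat \<bar>n\<bar>) summable_on UNIV"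
    by (intro summable_on_cmult_right) simp
  then show ?thesis
  proof (rule summable_on_comparison_test)
    fix n :: int
    have "\<bar>n\<bar> - K \<le> d * n\<^sup>2 + c * n"
    proof -
      have a: "n\<^sup>2 \<le> d * n\<^sup>2" using assms by (simp add: mult_le_cancel_right1)
      have b: "- (\<bar>c\<bar> * \<bar>n\<bar>) \<le> c * n" by (metis abs_mult abs_ge_minus_self minus_le_iff)
      have "0 \<le> (2 * \<bar>n\<bar> - (\<bar>c\<bar> + 1))\<^sup>2" by simp
      also have "\<dots> = 4 * (n\<^sup>2 - (\<bar>c\<bar> + 1) * \<bar>n\<bar>) + K"
        by (simp add: K_def power2_diff algebra_simps power_mult_distrib)
      finally have "0 \<le> 4 * (n\<^sup>2 - (\<bar>c\<bar> + 1) * \<bar>n\<bar>) + K" .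
      moreover have "0 \<le> K" by (simp add: K_def)
      ultimately have "(\<bar>c\<bar> + 1) * \<bar>n\<bar> \<le> n\<^sup>2 + K"
        by (simp only: right_diff_distrib)
      then show ?thesis using a b by (simp add: algebra_simps)
    qed
    then have "\<rho> powi (d * n\<^sup>2 + c * n) \<le> \<rho> powi (\<bar>n\<bar> - K)"
      using \<rho> by (intro power_int_decreasing) auto
    also have "\<rho> powi (\<bar>n\<bar> - K) = \<rho> powi (- K) * \<rho> ^ nat \<bar>n\<bar>"
      using \<rho> power_int_add[of \<rho> "- K" "\<bar>n\<bar>"] by (simp add: power_int_def)
    finally show "norm (q powi (d * n\<^sup>2 + c * n)) \<le> \<rho> powi (- K) * \<rho> ^ nat \<bar>n\<bar>"
      by (simp add: norm_power_int \<rho>_def)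
  qed simp
qed

lemma qfact_eq_prod: "qfact q n = (\<Prod>j<n. 1 - q * q ^ j)"
  by (induction n) (simp_all add: qfact_Suc)

lemma qpoch_inf_self_nz: "qpoch_inf q q \<noteq> 0"
  by (rule qpoch_inf_nz) (rule norm_q)+

lemma iqfact_tendsto: "(\<lambda>M. iqfact q (int M + k)) \<longlonglongrightarrow> 1 / qpoch_inf q q"
proof -
  have "(\<lambda>n. qfact q n) \<longlonglongrightarrow> qpoch_inf q q"
    unfolding qfact_eq_prod by (rule qpoch_inf_LIMSEQ[OF norm_q])
  then have l: "(\<lambda>n. 1 / qfact q n) \<longlonglongrightarrow> 1 / qpoch_inf q q"
    by (intro tendsto_intros qpoch_inf_self_nz)
  have "filterlim (\<lambda>M. nat (int M + k)) sequentially sequentially"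
    unfolding filterlim_at_top eventually_at_top_linorder
  proof
    fix Z
    show "\<exists>N. \<forall>n\<ge>N. Z \<le> nat (int n + k)"
      by (rule exI[of _ "Z + nat (- k)"]) auto
  qed
  from filterlim_compose[OF l this]
  show ?thesis
  proof (rule Lim_transform_eventually)
    show "\<forall>\<^sub>F M in sequentially. 1 / qfact q (nat (int M + k)) = iqfact q (int M + k)"
      unfolding eventually_at_top_linorder
      by (rule exI[of _ "nat (- k)"]) (auto simp: iqfact_def)
  qed
qed

lemma iqfact_bounded: obtains B where "B > 0" "\<And>k. norm (iqfact q k) \<le> B"
proof -
  have "Bseq (\<lambda>M. iqfact q (int M))"
    using iqfact_tendsto[of 0] by (intro convergent_imp_Bseq) (auto simp: convergent_def)
  then obtain B where B: "B > 0" "\<And>n. norm (iqfact q (int n)) \<le> B"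
    by (auto simp: Bseq_def)
  have "norm (iqfact q k) \<le> B" for k
    using B by (cases "k < 0") (auto, metis not_less nonneg_int_cases)
  with B that show thesis by blast
qed

text \<open>With base \<open>Q = q^(2r)\<close>, the theta summand \<open>f\<close> satisfies a
  first-order recurrence under which each q-Pascal rule collapses to a single factor. This evaluates
  the kernel sum with ends \<open>a\<close> and \<open>b\<close> in closed form (a finite triple
  product); then \<open>a = b = M\<close> tends to infinity.\<close>

lemma jacobi_triple_product:
  assumes "r > 0"
  shows "(\<Sum>\<^sub>\<infinity>n. (-1) powi n * q powi (int r * (n\<^sup>2 - n) + e * n))
     = qpoch_inf_list [q ^ (2 * r), q powi e, q powi (2 * int r - e)] (q ^ (2 * r))"
proof -
  define Q where "Q = q ^ (2 * r)"
  interpret Q: nome Q unfolding Q_def using assms by (intro nome_power) simp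
  have Qp: "Q powi k = q powi (2 * int r * k)" for k
    using power_int_mult[of q "int (2 * r)" k] unfolding power_int_of_nat Q_def by simp
  define z w where "z = q powi e" and "w = q powi (2 * int r - e)"
  define f where "f n = (-1) powi n * q powi (int r * (n\<^sup>2 - n) + e * n)" for n
  have f_succ: "f (n + 1) = - (z * Q powi n * f n)" for n
  proof -
    have "q powi (int r * ((n + 1)\<^sup>2 - (n + 1)) + e * (n + 1)) = z * Q powi n * q powi (int r * (n\<^sup>2 - n) + e * n)"
      unfolding z_def Qp qpow_add by (rule arg_cong[of _ _ "(powi) q"]) algebra
    then show ?thesis by (simp add: f_def minus_one_powi_shift)
  qed
  have left: "(1 - Q powi (a + 1 + b)) * wsum Q (a + 1) b f = (1 - z * Q powi a) * wsum Q a b f" for a b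
  proof -
    have "f n + Q powi (a + 1 - n - 1) * f (n + 1) = (1 - z * Q powi a) * f n" for n
      using Q.qpow_add[of "a + 1 - n - 1" n] unfolding f_succ by (simp add: algebra_simps)
    then show ?thesis
      using Q.wsum_split_left[of "a + 1" b f] by (simp only: wsum_cmult) simp
  qed
  have right: "(1 - Q powi (a + (b + 1))) * wsum Q a (b + 1) f = (1 - w * Q powi b) * wsum Q a b f" for a b
  proof -
    have "f (n + 1) + Q powi (b + 1 + n) * f n = (1 - w * Q powi b) * f (n + 1)" for n
    proof -
      \<comment> \<open>The two parameters satisfy \<open>w * z = Q\<close>.\<close>
      have "w * z * Q powi b * Q powi n = Q powi (b + 1 + n)"
        unfolding w_def z_def Qp qpow_add by (rule arg_cong[of _ _ "(powi) q"]) algebra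
      then show ?thesis unfolding f_succ by (simp add: algebra_simps)
    qed
    then have "(1 - Q powi (a + (b + 1))) * wsum Q a (b + 1) f = wsum Q (a - 1) (b + 1) (\<lambda>n. (1 - w * Q powi b) * f (n + 1))"
      using Q.wsum_split_right[of a "b + 1" f] by simp
    also have "\<dots> = (1 - w * Q powi b) * wsum Q a b f"
      using wsum_shift[of Q a b f] by (simp only: wsum_cmult)
    finally show ?thesis .
  qed
  have col: "wsum Q (int a) 0 f = (\<Prod>j<a. 1 - z * Q ^ j) * iqfact Q (int a)" for a
  proof (induction a)
    case 0
    show ?case by (simp add: wsum_0_0 f_def)
  next
    case (Suc a)
    have nz: "1 - Q powi (int a + 1) \<noteq> 0" using Q.powi_neq_1[of "int a + 1"] by simp
    have "(1 - Q powi (int a + 1)) * wsum Q (int a + 1) 0 f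
       = (1 - Q powi (int a + 1)) * ((\<Prod>j<Suc a. 1 - z * Q ^ j) * iqfact Q (int a + 1))"
      using left[of "int a" 0] Suc Q.iqfact_pred[of "int a + 1"] by (simp add: mult_ac)
    then show ?case using nz by (simp add: add.commute)
  qed
  have fin: "wsum Q (int a) (int b) f
      = (\<Prod>j<a. 1 - z * Q ^ j) * (\<Prod>j<b. 1 - w * Q ^ j) * iqfact Q (int a + int b)" for a b
  proof (induction b)
    case 0
    show ?case by (simp add: col)
  next
    case (Suc b)
    have nz: "1 - Q powi (int a + int b + 1) \<noteq> 0" using Q.powi_neq_1[of "int a + int b + 1"] by simp
    have "(1 - Q powi (int a + int b + 1)) * wsum Q (int a) (int b + 1) f
       = (1 - Q powi (int a + int b + 1)) * ((\<Prod>j<a. 1 - z * Q ^ j) * (\<Prod>j<Suc b. 1 - w * Q ^ j) * iqfact Q (int a + int b + 1))"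
      using right[of "int a" "int b"] Suc Q.iqfact_pred[of "int a + int b + 1"] by (simp add: mult_ac add_ac)
    then show ?case using nz by (simp add: add_ac)
  qed
  let ?P = "qpoch_inf Q Q"
  obtain B where B: "B > 0" "\<And>k. norm (iqfact Q k) \<le> B" using Q.iqfact_bounded by blast
  have "(\<lambda>n. norm (f n)) summable_on UNIV"
  proof -
    have "norm (f n) = norm (q powi (int r * n\<^sup>2 + (e - int r) * n))" for n
      by (simp add: f_def norm_mult norm_power_int algebra_simps)
    then show ?thesis using powi_quadratic_summable[of "int r" "e - int r"] assms by simp
  qed
  then have "(\<lambda>n. norm (f n) * (B * B)) summable_on UNIV"
    by (rule summable_on_cmult_left)
  moreover have "(\<lambda>M. f n * (iqfact Q (int M - n) * iqfact Q (int M + n))) \<longlonglongrightarrow> f n * (1 / ?P * (1 / ?P))" for n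
    using Q.iqfact_tendsto[of "- n"] Q.iqfact_tendsto[of n] by (intro tendsto_intros) auto
  moreover have "norm (f n * (iqfact Q (int M - n) * iqfact Q (int M + n))) \<le> norm (f n) * (B * B)" for M n
    unfolding norm_mult using B by (intro mult_left_mono mult_mono) (auto intro: less_imp_le)
  ultimately have "(\<lambda>M. wsum Q (int M) (int M) f) \<longlonglongrightarrow> (\<Sum>\<^sub>\<infinity>n. f n * (1 / ?P * (1 / ?P)))"
    unfolding wsum_def by (rule tannery)
  moreover have "(\<lambda>M. wsum Q (int M) (int M) f) \<longlonglongrightarrow> qpoch_inf z Q * qpoch_inf w Q * (1 / ?P)"
  proof -
    \<comment> \<open>The finite form carries \<open>1 / (Q)_(a+b)\<close>, here with index
      \<open>2M\<close>.\<close>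
    have "filterlim (\<lambda>M. 2 * M) sequentially (sequentially :: nat filter)"
      by (rule filterlim_subseq) (auto simp: strict_mono_def)
    from filterlim_compose[OF Q.iqfact_tendsto[of 0] this]
    have "(\<lambda>M. iqfact Q (int M + int M)) \<longlonglongrightarrow> 1 / ?P"
      by simp
    then show ?thesis
      unfolding fin by (intro tendsto_intros qpoch_inf_LIMSEQ Q.norm_q)
  qed
  ultimately have "(\<Sum>\<^sub>\<infinity>n. f n) * (1 / ?P * (1 / ?P)) = qpoch_inf z Q * qpoch_inf w Q * (1 / ?P)"
    unfolding infsum_cmult_left'[symmetric] by (rule LIMSEQ_unique)
  then have "(\<Sum>\<^sub>\<infinity>n. f n) = ?P * (qpoch_inf z Q * qpoch_inf w Q)"
    using Q.qpoch_inf_self_nz by (simp add: field_simps)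
  then show ?thesis
    by (simp add: qpoch_inf_list_def f_def Q_def z_def w_def)
qed

end

subsection \<open>Bailey steps and descending tuples\<close>

lemma infsum_sum_swap:
  fixes f :: "'a \<Rightarrow> 'b \<Rightarrow> complex"
  assumes "finite A" "\<And>x. x \<in> A \<Longrightarrow> f x summable_on B"
  shows "(\<Sum>x\<in>A. infsum (f x) B) = (\<Sum>\<^sub>\<infinity>y\<in>B. \<Sum>x\<in>A. f x y)"
proof -
  have "((\<lambda>y. \<Sum>x\<in>A. f x y) has_sum (\<Sum>x\<in>A. infsum (f x) B)) B"
    using assms by (induction A rule: finite_induct) (auto intro!: has_sum_add has_sum_infsum)
  then show ?thesis by (rule infsumI[symmetric])
qed

lemma summable_on_finite_sum:
  fixes f :: "'a \<Rightarrow> 'b \<Rightarrow> real"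
  assumes "finite A" "\<And>x. x \<in> A \<Longrightarrow> f x summable_on B"
  shows "(\<lambda>y. \<Sum>x\<in>A. f x y) summable_on B"
  using assms by (induction A rule: finite_induct) (auto intro!: summable_on_add)

lemma bij_betw_desc_tuples_Suc:
  assumes "k \<ge> 1"
  shows "bij_betw (\<lambda>(s, t). s(Suc k := t)) (SIGMA s:desc_tuples k b. {b..s k}) (desc_tuples (Suc k) b)"
proof (rule bij_betwI[where g = "\<lambda>s. (s(Suc k := undefined), s (Suc k))"])
  show "(\<lambda>(s, t). s(Suc k := t)) \<in> (SIGMA s:desc_tuples k b. {b..s k}) \<rightarrow> desc_tuples (Suc k) b"
    using assms by (auto simp: desc_tuples_def PiE_def extensional_def less_Suc_eq)
next
  show "(\<lambda>s. (s(Suc k := undefined), s (Suc k))) \<in> desc_tuples (Suc k) b \<rightarrow> (SIGMA s:desc_tuples k b. {b..s k})"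
  proof
    fix s assume s: "s \<in> desc_tuples (Suc k) b"
    have "s k \<ge> s (Suc k)" "s (Suc k) \<ge> b" using s assms by (auto simp: desc_tuples_def)
    then have "b \<le> s k" by simp
    then show "(s(Suc k := undefined), s (Suc k)) \<in> (SIGMA s:desc_tuples k b. {b..s k})"
      using s assms by (auto simp: desc_tuples_def PiE_def extensional_def intro: \<open>b \<le> s k\<close>)
  qed
next
  fix p assume "p \<in> (SIGMA s:desc_tuples k b. {b..s k})"
  then show "((case p of (s, t) \<Rightarrow> s(Suc k := t))(Suc k := undefined), (case p of (s, t) \<Rightarrow> s(Suc k := t)) (Suc k)) = p"
    by (auto simp: desc_tuples_def PiE_def extensional_def fun_eq_iff)
qed auto

text \<open>The last entry of a descending tuple ranges over the finite interval from
  \<open>b\<close> to the entry before it, so it can be summed first. Summability of the partial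
  sums is included to allow iteration.\<close>

lemma desc_tuples_Suc:
  fixes f :: "(nat \<Rightarrow> int) \<Rightarrow> complex"
  assumes "k \<ge> 1" and f: "f summable_on desc_tuples (Suc k) b"
  shows "(\<lambda>s. \<Sum>t\<in>{b..s k}. f (s(Suc k := t))) summable_on desc_tuples k b"
    and "infsum f (desc_tuples (Suc k) b) = infsum (\<lambda>s. \<Sum>t\<in>{b..s k}. f (s(Suc k := t))) (desc_tuples k b)"
proof -
  let ?g = "\<lambda>s. \<Sum>t\<in>{b..s k}. f (s(Suc k := t))"
  let ?h = "\<lambda>(s, t). s(Suc k := t)"
  let ?S = "SIGMA s:desc_tuples k b. {b..s k}"
  note bij = bij_betw_desc_tuples_Suc[OF assms(1), of b]
  have s: "(\<lambda>p. f (?h p)) summable_on ?S"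
    using summable_on_reindex_bij_betw[OF bij, of f] f by simp
  have "(\<lambda>s. \<Sum>\<^sub>\<infinity>t\<in>{b..s k}. f (?h (s, t))) summable_on desc_tuples k b"
    by (rule summable_on_Sigma_banach) (use s in \<open>simp add: case_prod_unfold\<close>)
  then show "?g summable_on desc_tuples k b" by simp
  have "infsum f (desc_tuples (Suc k) b) = infsum (\<lambda>p. f (?h p)) ?S"
    using infsum_reindex_bij_betw[OF bij, of f] by simp
  also have "\<dots> = infsum (\<lambda>s. infsum (\<lambda>t. f (?h (s, t))) {b..s k}) (desc_tuples k b)"
    by (rule infsum_Sigma_banach[OF s, symmetric])
  finally show "infsum f (desc_tuples (Suc k) b) = infsum ?g (desc_tuples k b)" by simp
qed

lemma bij_betw_desc_tuples_1: "bij_betw (\<lambda>n. (\<lambda>j. undefined)(1 := n)) {b..} (desc_tuples 1 b)"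
  by (rule bij_betwI[where g = "\<lambda>s. s 1"]) (auto simp: desc_tuples_def PiE_def extensional_def fun_eq_iff)

lemma summable_on_prod_PiE:
  fixes f :: "'a \<Rightarrow> 'b::countable \<Rightarrow> complex"
  assumes "finite A" "\<And>x. x \<in> A \<Longrightarrow> (\<lambda>y. norm (f x y)) summable_on UNIV"
  shows "(\<lambda>g. norm (\<Prod>x\<in>A. f x (g x))) summable_on (A \<rightarrow>\<^sub>E UNIV)"
  unfolding abs_summable_equivalent
  by (rule abs_summable_on_prod_PiE) (use assms in \<open>auto simp flip: abs_summable_equivalent\<close>)

section \<open>Plain and lattice Bailey steps\<close>

context nome
begin

text \<open>The brackets are written as geometric sums rather than quotients because
  \<open>x = q^(m+2n)\<close> equals 1 when \<open>m + 2n = 0\<close>.\<close>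

definition lattice_factor :: "int \<Rightarrow> nat \<Rightarrow> int \<Rightarrow> int \<Rightarrow> complex" where
  "lattice_factor m d N n = (\<Sum>k<Suc d. q powi (int k * (m + 2 * n)))
     - q powi (N + m + n) * (\<Sum>k<d. q powi (int k * (m + 2 * n)))"

lemma lattice_factor_0 [simp]: "lattice_factor m 0 N n = 1"
  by (simp add: lattice_factor_def)

text \<open>The indices \<open>N - n\<close> and \<open>N + m + n\<close> add up to
  \<open>2N + m\<close>, so below \<open>b\<close> one of them is negative and the kernel vanishes;
  above \<open>M\<close> the factor \<open>iqfact q (M - N)\<close> does. The range of
  \<open>N\<close> thus extends to all integers, and the order of summation is exchanged.\<close>

lemma sum_wsum_eq:
  assumes b: "\<forall>N<b. 2 * N + m < 0"
  shows "(\<Sum>N\<in>{b..M}. g N * (iqfact q (M - N) * wsum q N (N + m) (f N)))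
    = (\<Sum>\<^sub>\<infinity>n. \<Sum>\<^sub>\<infinity>N. g N * f N n * (iqfact q (M - N) * (iqfact q (N - n) * iqfact q (N + m + n))))"
proof -
  have "(\<Sum>N\<in>{b..M}. g N * (iqfact q (M - N) * wsum q N (N + m) (f N)))
    = (\<Sum>N\<in>{b..M}. \<Sum>\<^sub>\<infinity>n. g N * f N n * (iqfact q (M - N) * (iqfact q (N - n) * iqfact q (N + m + n))))"
    unfolding wsum_def infsum_cmult_right'[symmetric] by (simp add: mult_ac)
  also have "\<dots> = (\<Sum>\<^sub>\<infinity>n. \<Sum>N\<in>{b..M}. g N * f N n * (iqfact q (M - N) * (iqfact q (N - n) * iqfact q (N + m + n))))"
  proof (rule infsum_sum_swap)
    fix N
    show "(\<lambda>n. g N * f N n * (iqfact q (M - N) * (iqfact q (N - n) * iqfact q (N + m + n)))) summable_on UNIV"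
      by (rule summable_on_zero_outside[of "- N - m" N]) auto
  qed simp
  also have "\<dots> = (\<Sum>\<^sub>\<infinity>n. \<Sum>\<^sub>\<infinity>N. g N * f N n * (iqfact q (M - N) * (iqfact q (N - n) * iqfact q (N + m + n))))"
  proof (rule infsum_cong)
    fix n
    have "(\<Sum>\<^sub>\<infinity>N. g N * f N n * (iqfact q (M - N) * (iqfact q (N - n) * iqfact q (N + m + n))))
        = (\<Sum>\<^sub>\<infinity>N\<in>{b..M}. g N * f N n * (iqfact q (M - N) * (iqfact q (N - n) * iqfact q (N + m + n))))"
    proof (rule infsum_cong_neutral)
      fix N assume "N \<in> UNIV - {b..M}"
      then consider "N < b" | "N > M" by fastforce
      then show "g N * f N n * (iqfact q (M - N) * (iqfact q (N - n) * iqfact q (N + m + n))) = 0"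
      proof cases
        case 1
        then have "N - n < 0 \<or> N + m + n < 0" using b by force
        then show ?thesis by auto
      qed simp
    qed auto
    then show "(\<Sum>N\<in>{b..M}. g N * f N n * (iqfact q (M - N) * (iqfact q (N - n) * iqfact q (N + m + n))))
       = (\<Sum>\<^sub>\<infinity>N. g N * f N n * (iqfact q (M - N) * (iqfact q (N - n) * iqfact q (N + m + n))))" by simp
  qed
  finally show ?thesis .
qed

lemma bailey_step:
  assumes b: "\<forall>N<b. 2 * N + m < 0"
  shows "(\<Sum>N\<in>{b..M}. q powi (N\<^sup>2 + m * N) * (iqfact q (M - N) * wsum q N (N + m) \<kappa>))
    = wsum q M (M + m) (\<lambda>n. q powi (n\<^sup>2 + m * n) * \<kappa> n)"
proof -
  have "(\<Sum>\<^sub>\<infinity>N. q powi (N\<^sup>2 + m * N) * \<kappa> n * (iqfact q (M - N) * (iqfact q (N - n) * iqfact q (N + m + n))))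
     = \<kappa> n * (\<Sum>\<^sub>\<infinity>N. q powi (N\<^sup>2 + m * N) * (iqfact q (M - N) * (iqfact q (N - n) * iqfact q (N + m + n))))" for n
    unfolding infsum_cmult_right'[symmetric] by (simp add: mult_ac)
  then show ?thesis
    unfolding sum_wsum_eq[OF b] unfolding q_vandermonde wsum_def by (simp add: mult_ac)
qed

text \<open>The \<open>[d+1]\<close> part is summed by the shifted q-Vandermonde formula. In the
  \<open>[d]\<close> part the factor \<open>q^(N+m+n)\<close> restores the exponent
  \<open>N^2 + m N\<close>, so the ordinary formula applies. They recombine by
  \<open>[d+2] = (1 + x) [d+1] - x [d]\<close>.\<close>

lemma bailey_lattice_step:
  assumes b: "\<forall>N<b. 2 * N + m < 0"
  shows "(\<Sum>N\<in>{b..M}. q powi (N\<^sup>2 + (m - 1) * N) * (iqfact q (M - N) * wsum q N (N + m) (\<lambda>n. \<kappa> n * lattice_factor m d N n)))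
    = wsum q M (M + m) (\<lambda>n. q powi (n\<^sup>2 + (m - 1) * n) * \<kappa> n * lattice_factor m (Suc d) M n)"
proof -
  define br where "br d n = (\<Sum>k<d. q powi (int k * (m + 2 * n)))" for d n
  have lattice_factor: "lattice_factor m d N n = br (Suc d) n - q powi (N + m + n) * br d n" for d N n
    by (simp only: lattice_factor_def br_def)
  have br_Suc: "br (Suc d) n = br d n + q powi (int d * (m + 2 * n))" for d n
    by (simp add: br_def)
  have summ: "(\<lambda>N. f N * (iqfact q (M - N) * (iqfact q (N - n) * g N))) summable_on UNIV" for f g n
    by (rule summable_on_zero_outside[of n M]) auto
  have inner: "(\<Sum>\<^sub>\<infinity>N. q powi (N\<^sup>2 + (m - 1) * N) * (\<kappa> n * lattice_factor m d N n) * (iqfact q (M - N) * (iqfact q (N - n) * iqfact q (N + m + n))))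
     = q powi (n\<^sup>2 + (m - 1) * n) * \<kappa> n * lattice_factor m (Suc d) M n * (iqfact q (M - n) * iqfact q (M + m + n))" for n
  proof -
    let ?I = "\<lambda>N. iqfact q (M - N) * (iqfact q (N - n) * iqfact q (N + m + n))"
    have e: "q powi (N\<^sup>2 + (m - 1) * N) * q powi (N + m + n) = q powi (m + n) * q powi (N\<^sup>2 + m * N)" for N
      unfolding qpow_add by (simp add: algebra_simps)
    have "(\<Sum>\<^sub>\<infinity>N. q powi (N\<^sup>2 + (m - 1) * N) * (\<kappa> n * lattice_factor m d N n) * ?I N)
       = (\<Sum>\<^sub>\<infinity>N. \<kappa> n * br (Suc d) n * (q powi (N\<^sup>2 + (m - 1) * N) * ?I N)
             + (- \<kappa> n * br d n * q powi (m + n)) * (q powi (N\<^sup>2 + m * N) * ?I N))"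
    proof (rule infsum_cong)
      fix N
      show "q powi (N\<^sup>2 + (m - 1) * N) * (\<kappa> n * lattice_factor m d N n) * ?I N
        = \<kappa> n * br (Suc d) n * (q powi (N\<^sup>2 + (m - 1) * N) * ?I N)
             + (- \<kappa> n * br d n * q powi (m + n)) * (q powi (N\<^sup>2 + m * N) * ?I N)"
        using e[of N] unfolding lattice_factor by algebra
    qed
    also have "\<dots> = \<kappa> n * br (Suc d) n * (\<Sum>\<^sub>\<infinity>N. q powi (N\<^sup>2 + (m - 1) * N) * ?I N)
             + (- \<kappa> n * br d n * q powi (m + n)) * (\<Sum>\<^sub>\<infinity>N. q powi (N\<^sup>2 + m * N) * ?I N)"
      unfolding infsum_cmult_right'[symmetric]
      by (rule infsum_add[OF summable_on_cmult_right[OF summ] summable_on_cmult_right[OF summ]])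
    also have "\<dots> = q powi (n\<^sup>2 + (m - 1) * n) * \<kappa> n * lattice_factor m (Suc d) M n * (iqfact q (M - n) * iqfact q (M + m + n))"
    proof -
      have e1: "q powi (m + n) * q powi (n\<^sup>2 + m * n) = q powi (n\<^sup>2 + (m - 1) * n) * q powi (m + 2 * n)"
        unfolding qpow_add by (simp add: algebra_simps)
      have e2: "q powi (int (Suc d) * (m + 2 * n)) = q powi (m + 2 * n) * q powi (int d * (m + 2 * n))"
        unfolding qpow_add by (simp add: algebra_simps)
      show ?thesis
        unfolding q_vandermonde q_vandermonde_shifted lattice_factor br_Suc e2 using e1 by algebra
    qed
    finally show ?thesis .
  qed
  show ?thesis unfolding sum_wsum_eq[OF b] inner unfolding wsum_def ..
qed

section \<open>Eliminating the summation variables one at a time\<close>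

definition level_exp :: "nat \<Rightarrow> nat \<Rightarrow> nat \<Rightarrow> int \<Rightarrow> int" where
  "level_exp m i l N = N\<^sup>2 + (int m - of_bool (l \<le> i)) * N"

text \<open>The value of the sum over all variables after \<open>s j\<close>, as a function of
  \<open>N = s j\<close>, where \<open>K = r - 1\<close>. Natural subtraction in
  \<open>i - j\<close> keeps the lattice factor trivial until the variables \<open>s l\<close> with
  \<open>l <= i\<close> are summed. At \<open>j = 0\<close>, \<open>N\<close> is an auxiliary bound
  above \<open>s 1\<close>.\<close>

definition level :: "nat \<Rightarrow> nat \<Rightarrow> nat \<Rightarrow> nat \<Rightarrow> int \<Rightarrow> complex" where
  "level m i K j N = wsum q N (N + int m)
     (\<lambda>n. alpha n * (\<Prod>l\<in>{j<..K}. q powi level_exp m i l n) * lattice_factor (int m) (i - j) N n)"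

definition level_summand :: "nat \<Rightarrow> nat \<Rightarrow> nat \<Rightarrow> nat \<Rightarrow> (nat \<Rightarrow> int) \<Rightarrow> complex" where
  "level_summand m i K j s = (\<Prod>l=1..j. q powi level_exp m i l (s l)) * (\<Prod>l=1..<j. iqfact q (s l - s (l + 1)))
     * level m i K j (s j)"

definition summand :: "nat \<Rightarrow> nat \<Rightarrow> nat \<Rightarrow> (nat \<Rightarrow> int) \<Rightarrow> complex" where
  "summand m i K s = (\<Prod>l=1..K. q powi level_exp m i l (s l)) * (\<Prod>l=1..<K. iqfact q (s l - s (l + 1)))
     * (q powi s K * ((-1) powi s (Suc K) * q powi ((s (Suc K))\<^sup>2 - 2 * s (Suc K))
          * (beta_coeff (int m) (s (Suc K)) * iqfact (q\<^sup>2) (s K - s (Suc K)))))"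

text \<open>For \<open>Suc j <= i\<close> the exponent carries the extra \<open>-N\<close>, so the
  lattice step applies and raises \<open>d\<close> from \<open>i - Suc j\<close> to
  \<open>i - j\<close>. Otherwise both differences are 0 and the plain step applies.\<close>

lemma level_step:
  assumes b: "\<forall>N<b. 2 * N + int m < 0" and "j < K"
  shows "(\<Sum>N\<in>{b..M}. q powi level_exp m i (Suc j) N * (iqfact q (M - N) * level m i K (Suc j) N)) = level m i K j M"
proof -
  let ?\<kappa> = "\<lambda>n. alpha n * (\<Prod>l\<in>{Suc j<..K}. q powi level_exp m i l n)"
  have "{j<..K} = insert (Suc j) {Suc j<..K}" using \<open>j < K\<close> by auto
  then have prod: "alpha n * (\<Prod>l\<in>{j<..K}. q powi level_exp m i l n) = q powi level_exp m i (Suc j) n * ?\<kappa> n" for n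
    by simp
  show ?thesis
  proof (cases "Suc j \<le> i")
    case True
    then have "i - j = Suc (i - Suc j)" by simp
    then show ?thesis
      unfolding level_def prod using bailey_lattice_step[OF b, of M ?\<kappa> "i - Suc j"] True
      by (simp add: level_exp_def)
  next
    case False
    then show ?thesis
      unfolding level_def prod using bailey_step[OF b, of M ?\<kappa>] by (simp add: level_exp_def)
  qed
qed

lemma level_summand_step:
  assumes b: "\<forall>N<b. 2 * N + int m < 0" and "1 \<le> j" "j < K"
  shows "(\<Sum>t\<in>{b..s j}. level_summand m i K (Suc j) (s(Suc j := t))) = level_summand m i K j s"
proof -
  have e: "level_summand m i K (Suc j) (s(Suc j := t)) =
    (\<Prod>l=1..j. q powi level_exp m i l (s l)) * (\<Prod>l=1..<j. iqfact q (s l - s (l + 1)))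
     * (q powi level_exp m i (Suc j) t * (iqfact q (s j - t) * level m i K (Suc j) t))" for t
  proof -
    have "(\<Prod>l=1..<Suc j. iqfact q ((s(Suc j := t)) l - (s(Suc j := t)) (l + 1)))
       = (\<Prod>l=1..<j. iqfact q (s l - s (l + 1))) * iqfact q (s j - t)"
      using \<open>1 \<le> j\<close> by (simp add: prod.atLeastLessThan_Suc)
    moreover have "(\<Prod>l=1..Suc j. q powi level_exp m i l ((s(Suc j := t)) l))
       = (\<Prod>l=1..j. q powi level_exp m i l (s l)) * q powi level_exp m i (Suc j) t"
      by simp
    ultimately show ?thesis by (simp add: level_summand_def mult_ac)
  qed
  show ?thesis
    unfolding e sum_distrib_left[symmetric] level_step[OF b \<open>j < K\<close>] by (simp add: level_summand_def)
qed

text \<open>The descent stops at \<open>j = 1\<close> because \<open>s 1\<close> has no upper bound: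
  its sum is infinite and is treated by a limit.\<close>

lemma level_summand_infsum:
  assumes b: "\<forall>N<b. 2 * N + int m < 0"
    and "1 \<le> j" "j \<le> K" "level_summand m i K j summable_on desc_tuples j b"
  shows "level_summand m i K 1 summable_on desc_tuples 1 b
    \<and> infsum (level_summand m i K j) (desc_tuples j b) = infsum (level_summand m i K 1) (desc_tuples 1 b)"
  using assms(2-)
proof (induction j rule: nat_induct_at_least)
  case (Suc j)
  note step = desc_tuples_Suc[OF \<open>1 \<le> j\<close> Suc.prems(2), unfolded level_summand_step[OF b \<open>1 \<le> j\<close> Suc_le_lessD[OF Suc.prems(1)]]]
  show ?case using Suc.IH[OF _ step(1)] step(2) Suc.prems(1) by simp
qed simp

lemma summand_step:
  assumes b: "\<forall>N<b. 2 * N + int m < 0" and "1 \<le> K" "i \<le> K"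
  shows "(\<Sum>t\<in>{b..s K}. summand m i K (s(Suc K := t))) = level_summand m i K K s"
proof -
  have e: "summand m i K (s(Suc K := t)) =
    (\<Prod>l=1..K. q powi level_exp m i l (s l)) * (\<Prod>l=1..<K. iqfact q (s l - s (l + 1)))
     * (q powi s K * ((-1) powi t * q powi (t\<^sup>2 - 2 * t) * (beta_coeff (int m) t * iqfact (q\<^sup>2) (s K - t))))" for t
  proof -
    have "(\<Prod>l=1..<K. iqfact q ((s(Suc K := t)) l - (s(Suc K := t)) (l + 1)))
       = (\<Prod>l=1..<K. iqfact q (s l - s (l + 1)))" by simp
    moreover have "(\<Prod>l=1..K. q powi level_exp m i l ((s(Suc K := t)) l)) = (\<Prod>l=1..K. q powi level_exp m i l (s l))"
      by simp
    ultimately show ?thesis by (simp add: summand_def)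
  qed
  \<comment> \<open>Terms with \<open>t < b\<close> have \<open>m + 2t < 0\<close>, so restricting
    \<open>t\<close> to the tuple range loses nothing.\<close>
  have "beta_sum (s K) (int m) = (\<Sum>\<^sub>\<infinity>t\<in>{b..s K}. (-1) powi t * q powi (t\<^sup>2 - 2 * t) * (beta_coeff (int m) t * iqfact (q\<^sup>2) (s K - t)))"
    unfolding beta_sum_def
  proof (rule infsum_cong_neutral)
    fix t assume "t \<in> UNIV - {b..s K}"
    then have "t < b \<or> s K < t" by auto
    then have "int m + 2 * t < 0 \<or> s K - t < 0" using b by force
    then show "(-1) powi t * q powi (t\<^sup>2 - 2 * t) * (beta_coeff (int m) t * iqfact (q\<^sup>2) (s K - t)) = 0"
      by (auto simp: beta_coeff_def)
  qed auto
  then have "(\<Sum>t\<in>{b..s K}. summand m i K (s(Suc K := t))) =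
    (\<Prod>l=1..K. q powi level_exp m i l (s l)) * (\<Prod>l=1..<K. iqfact q (s l - s (l + 1)))
     * (q powi s K * beta_sum (s K) (int m))"
    unfolding e sum_distrib_left[symmetric] by simp
  also have "q powi s K * beta_sum (s K) (int m) = level m i K K (s K)"
    using alpha_sum_eq_beta_sum[of "s K" "Suc m"] \<open>i \<le> K\<close> by (simp add: level_def alpha_sum_def)
  finally show ?thesis unfolding level_summand_def .
qed

text \<open>The powers of \<open>q\<close> form a product of one-variable Gaussian terms, summable
  even over all integer tuples. The remaining factors are bounded.\<close>

lemma summand_summable: "1 \<le> K \<Longrightarrow> summand m i K summable_on desc_tuples (Suc K) b"
proof -
  assume "1 \<le> K"
  \<comment> \<open>Linear coefficients of the exponent: \<open>s K\<close> gains 1 from the factor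
    \<open>q powi s K\<close>, and the last variable contributes \<open>-2\<close>.\<close>
  define c where "c l = (if l = Suc K then - 2 else int m - of_bool (l \<le> i) + of_bool (l = K))" for l
  interpret q2: nome "q\<^sup>2" by (rule nome_power) simp
  obtain B where B: "B > 0" "\<And>k. norm (iqfact q k) \<le> B" using iqfact_bounded by blast
  obtain B2 where B2: "B2 > 0" "\<And>k. norm (iqfact (q\<^sup>2) k) \<le> B2" using q2.iqfact_bounded by blast
  \<comment> \<open>\<open>beta_coeff\<close> has finite support in \<open>t\<close>, so the sum of
    its norms bounds each value.\<close>
  define C where "C = (\<Sum>t\<in>{- int m..0}. norm (beta_coeff (int m) t))"
  have C: "norm (beta_coeff (int m) t) \<le> C" for t
  proof (cases "t \<in> {- int m..0}")
    case True
    then show ?thesis unfolding C_def by (rule member_le_sum) auto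
  next
    case False
    then have "beta_coeff (int m) t = 0" by (intro beta_coeff_eq_0) auto
    then show ?thesis unfolding C_def by (simp add: sum_nonneg)
  qed
  have "(\<lambda>s. norm (\<Prod>l\<in>{1..Suc K}. q powi (1 * (s l)\<^sup>2 + c l * s l))) summable_on ({1..Suc K} \<rightarrow>\<^sub>E UNIV)"
    by (rule summable_on_prod_PiE) (auto intro!: powi_quadratic_summable simp del: mult_1_left)
  then have "(\<lambda>s. norm (\<Prod>l\<in>{1..Suc K}. q powi (1 * (s l)\<^sup>2 + c l * s l))) summable_on desc_tuples (Suc K) b"
    by (rule summable_on_subset) (auto simp: desc_tuples_def)
  then have "(\<lambda>s. norm (\<Prod>l\<in>{1..Suc K}. q powi (1 * (s l)\<^sup>2 + c l * s l)) * (B ^ (K - 1) * (C * B2))) summable_on desc_tuples (Suc K) b"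
    by (rule summable_on_cmult_left)
  then have "(\<lambda>s. norm (summand m i K s)) summable_on desc_tuples (Suc K) b"
  proof (rule summable_on_comparison_test)
    fix s
    have "(\<Prod>l=1..K. q powi ((s l)\<^sup>2 + c l * s l))
        = (\<Prod>l=1..K. q powi level_exp m i l (s l) * (if l = K then q powi s K else 1))"
      by (rule prod.cong) (auto simp: c_def level_exp_def qpow_add algebra_simps)
    also have "\<dots> = (\<Prod>l=1..K. q powi level_exp m i l (s l)) * q powi s K"
      using \<open>1 \<le> K\<close> by (simp add: prod.distrib)
    finally have "(\<Prod>l\<in>{1..Suc K}. q powi (1 * (s l)\<^sup>2 + c l * s l))
        = (\<Prod>l=1..K. q powi level_exp m i l (s l)) * q powi s K * q powi ((s (Suc K))\<^sup>2 - 2 * s (Suc K))"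
      by (simp add: c_def)
    then have "summand m i K s = (\<Prod>l\<in>{1..Suc K}. q powi (1 * (s l)\<^sup>2 + c l * s l)) *
       ((\<Prod>l=1..<K. iqfact q (s l - s (l + 1))) * ((-1) powi s (Suc K) * beta_coeff (int m) (s (Suc K)) * iqfact (q\<^sup>2) (s K - s (Suc K))))"
      by (simp add: summand_def mult_ac)
    moreover have "norm (\<Prod>l=1..<K. iqfact q (s l - s (l + 1))) \<le> B ^ (K - 1)"
      unfolding prod_norm[symmetric] using prod_mono[of "{1..<K}" "\<lambda>l. norm (iqfact q (s l - s (l + 1)))" "\<lambda>_. B"] B by simp
    ultimately show "norm (summand m i K s) \<le> norm (\<Prod>l\<in>{1..Suc K}. q powi (1 * (s l)\<^sup>2 + c l * s l)) * (B ^ (K - 1) * (C * B2))"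
      using B B2 C[of "s (Suc K)"] B2(2)[of "s K - s (Suc K)"]
      by (simp only: norm_mult) (intro mult_left_mono mult_mono; auto simp: norm_power_int C_def sum_nonneg less_imp_le)
  qed simp
  then show ?thesis by (rule abs_summable_summable)
qed

section \<open>The limit of the outer bound and the resulting theta series\<close>

lemma level_0_eq:
  "level m i K 0 M = (\<Sum>\<^sub>\<infinity>n. (-1) powi n * q powi ((int K + 1) * n\<^sup>2 + (int K * int m - 1 - int (min i K)) * n)
      * (lattice_factor (int m) i M n * (iqfact q (M - n) * iqfact q (M + int m + n))))"
proof -
  have "alpha n * (\<Prod>l\<in>{0<..K}. q powi level_exp m i l n)
     = (-1) powi n * q powi ((int K + 1) * n\<^sup>2 + (int K * int m - 1 - int (min i K)) * n)" for n
  proof -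
    \<comment> \<open>\<open>min i K\<close> counts the levels \<open>l <= K\<close> with
      \<open>l <= i\<close>; stated this way, the formula holds for every \<open>K\<close> and
      admits induction.\<close>
    have "(\<Prod>l\<in>{0<..K}. q powi level_exp m i l n) = q powi (int K * n\<^sup>2 + (int K * int m - int (min i K)) * n)"
    proof (induction K)
      case (Suc K)
      have "{0<..Suc K} = insert (Suc K) {0<..K}" by auto
      then have "(\<Prod>l\<in>{0<..Suc K}. q powi level_exp m i l n) =
         q powi level_exp m i (Suc K) n * q powi (int K * n\<^sup>2 + (int K * int m - int (min i K)) * n)"
        by (simp add: Suc)
      also have "\<dots> = q powi (int (Suc K) * n\<^sup>2 + (int (Suc K) * int m - int (min i (Suc K))) * n)"
        unfolding qpow_add level_exp_def by (cases "Suc K \<le> i") (simp_all add: min_def algebra_simps)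
      finally show ?case .
    qed simp
    then show ?thesis by (simp add: alpha_def qpow_add algebra_simps)
  qed
  then show ?thesis by (simp add: level_def wsum_def mult_ac)
qed

text \<open>The second bracket of the lattice factor carries \<open>q^(M+m+n)\<close> and dies in
  the limit. The first leaves \<open>i + 1\<close> powers of \<open>x = q^(m+2n)\<close>, each
  giving a factor \<open>q^(mk)\<close> and a theta series.\<close>

lemma level_0_tendsto:
  assumes "i \<le> K"
  shows "(\<lambda>M. level m i K 0 (int M)) \<longlonglongrightarrow>
    (\<Sum>k\<le>i. q ^ (m * k) * (\<Sum>\<^sub>\<infinity>n. (-1) powi n * q powi ((int K + 1) * n\<^sup>2 + (int K * int m - 1 - int i + 2 * int k) * n)))
      * (1 / qpoch_inf q q * (1 / qpoch_inf q q))"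
proof -
  let ?P = "1 / qpoch_inf q q"
  define w where "w n = (-1) powi n * q powi ((int K + 1) * n\<^sup>2 + (int K * int m - 1 - int i) * n)" for n
  define x where "x k n = q powi (int k * (int m + 2 * n))" for k n
  have wx: "w n * x k n = q ^ (m * k) * ((-1) powi n * q powi ((int K + 1) * n\<^sup>2 + (int K * int m - 1 - int i + 2 * int k) * n))" for k n
  proof -
    have "q powi ((int K + 1) * n\<^sup>2 + (int K * int m - 1 - int i) * n) * q powi (int k * (int m + 2 * n))
      = q powi (int (m * k)) * q powi ((int K + 1) * n\<^sup>2 + (int K * int m - 1 - int i + 2 * int k) * n)"
      unfolding qpow_add by (simp add: algebra_simps)
    then show ?thesis unfolding power_int_of_nat by (simp add: w_def x_def mult_ac)
  qed
  have wx_summ: "(\<lambda>n. norm (w n * x k n)) summable_on UNIV" for k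
    unfolding wx norm_mult[of "q ^ _"]
    by (rule summable_on_cmult_right)
       (use powi_quadratic_summable[of "int K + 1" "int K * int m - 1 - int i + 2 * int k"] in
         \<open>simp add: norm_mult norm_power_int\<close>)
  obtain B where B: "B > 0" "\<And>k. norm (iqfact q k) \<le> B" using iqfact_bounded by blast
  have lim: "(\<lambda>M. level m i K 0 (int M)) \<longlonglongrightarrow> (\<Sum>\<^sub>\<infinity>n. w n * ((\<Sum>k\<le>i. x k n) * (?P * ?P)))"
    unfolding level_0_eq min_absorb1[OF assms] w_def[symmetric]
  proof (rule tannery)
    show "(\<lambda>n. (\<Sum>k\<le>i. norm (w n * x k n)) * (2 * (B * B))) summable_on UNIV"
      by (intro summable_on_cmult_left summable_on_finite_sum wx_summ) simp
  next
    fix n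
    have "(\<lambda>M. q powi (int M + int m + n)) \<longlonglongrightarrow> 0"
    proof -
      have "(\<lambda>M. q powi (int m + n) * q ^ M) \<longlonglongrightarrow> q powi (int m + n) * 0"
        by (intro tendsto_intros LIMSEQ_power_zero norm_q)
      moreover have "q powi (int M + int m + n) = q powi (int m + n) * q ^ M" for M
        using qpow_add[of "int m + n" "int M"] by (simp add: add_ac)
      ultimately show ?thesis by simp
    qed
    moreover have "(\<lambda>M. iqfact q (int M - n)) \<longlonglongrightarrow> ?P" "(\<lambda>M. iqfact q (int M + int m + n)) \<longlonglongrightarrow> ?P"
      using iqfact_tendsto[of "- n"] iqfact_tendsto[of "int m + n"] by (simp_all add: add.assoc)
    ultimately have "(\<lambda>M. w n * (lattice_factor (int m) i (int M) n * (iqfact q (int M - n) * iqfact q (int M + int m + n))))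
       \<longlonglongrightarrow> w n * (((\<Sum>k<Suc i. x k n) - 0 * (\<Sum>k<i. x k n)) * (?P * ?P))"
      unfolding lattice_factor_def x_def by (intro tendsto_intros)
    then show "(\<lambda>M. w n * (lattice_factor (int m) i (int M) n * (iqfact q (int M - n) * iqfact q (int M + int m + n))))
       \<longlonglongrightarrow> w n * ((\<Sum>k\<le>i. x k n) * (?P * ?P))"
      by (simp only: lessThan_Suc_atMost mult_zero_left diff_zero)
  next
    fix M n
    show "norm (w n * (lattice_factor (int m) i (int M) n * (iqfact q (int M - n) * iqfact q (int M + int m + n))))
       \<le> (\<Sum>k\<le>i. norm (w n * x k n)) * (2 * (B * B))"
    \<comment> \<open>In the negative case the kernel is 0. Otherwise \<open>q^(M+m+n)\<close> has
      norm at most 1, so each of the two brackets is bounded by the sum of the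
      \<open>norm (x k n)\<close>; hence the constant 2.\<close>
    proof (cases "int M + int m + n < 0")
      case False
      then have "norm (q powi (int M + int m + n)) \<le> 1"
        using norm_q by (simp add: powi_nonneg norm_power power_le_one)
      moreover have "norm (\<Sum>k<i. x k n) \<le> (\<Sum>k\<le>i. norm (x k n))"
        by (rule order_trans[OF norm_sum sum_mono2]) auto
      ultimately have "norm (q powi (int M + int m + n) * (\<Sum>k<i. x k n)) \<le> 1 * (\<Sum>k\<le>i. norm (x k n))"
        unfolding norm_mult by (intro mult_mono) auto
      moreover have "norm (\<Sum>k<Suc i. x k n) \<le> (\<Sum>k\<le>i. norm (x k n))"
        unfolding lessThan_Suc_atMost by (rule norm_sum)
      ultimately have "norm (lattice_factor (int m) i (int M) n) \<le> 2 * (\<Sum>k\<le>i. norm (x k n))"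
        unfolding lattice_factor_def x_def[symmetric]
        by (intro order_trans[OF norm_triangle_ineq4]) linarith
      then have "norm (w n) * (norm (lattice_factor (int m) i (int M) n) * (norm (iqfact q (int M - n)) * norm (iqfact q (int M + int m + n))))
        \<le> norm (w n) * ((2 * (\<Sum>k\<le>i. norm (x k n))) * (B * B))"
        using B by (intro mult_left_mono mult_mono) (auto simp: less_imp_le sum_nonneg)
      then show ?thesis
        by (simp add: norm_mult sum_distrib_left[symmetric] mult_ac)
    qed (use B in \<open>auto intro!: mult_nonneg_nonneg sum_nonneg simp: less_imp_le\<close>)
  qed
  have "(\<Sum>\<^sub>\<infinity>n. w n * ((\<Sum>k\<le>i. x k n) * (?P * ?P))) = (\<Sum>\<^sub>\<infinity>n. \<Sum>k\<le>i. w n * x k n) * (?P * ?P)"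
    unfolding infsum_cmult_left'[symmetric] by (simp add: sum_distrib_left sum_divide_distrib mult_ac)
  also have "(\<Sum>\<^sub>\<infinity>n. \<Sum>k\<le>i. w n * x k n) = (\<Sum>k\<le>i. \<Sum>\<^sub>\<infinity>n. w n * x k n)"
    by (rule infsum_sum_swap[symmetric]) (use wx_summ in \<open>auto intro: abs_summable_summable\<close>)
  finally show ?thesis using lim unfolding wx infsum_cmult_right' by simp
qed

text \<open>Inserting \<open>1 / (q)_(M - s 1)\<close> turns the sum over \<open>s 1\<close> into
  \<open>level\<close> at \<open>j = 0\<close>. As \<open>M\<close> grows this factor tends to
  \<open>1 / (q;q)_inf\<close>, which cancels one of the two such factors in
  \<open>level_0_tendsto\<close>.\<close>

lemma level_summand_1_infsum:
  assumes b: "\<forall>N<b. 2 * N + int m < 0" and "1 \<le> K" "i \<le> K"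
    and summ: "level_summand m i K 1 summable_on desc_tuples 1 b"
  shows "infsum (level_summand m i K 1) (desc_tuples 1 b) =
    (\<Sum>k\<le>i. q ^ (m * k) * (\<Sum>\<^sub>\<infinity>n. (-1) powi n * q powi ((int K + 1) * n\<^sup>2 + (int K * int m - 1 - int i + 2 * int k) * n)))
      * (1 / qpoch_inf q q)"
proof -
  let ?P = "1 / qpoch_inf q q"
  define h where "h N = q powi level_exp m i 1 N * level m i K 1 N" for N
  have e: "level_summand m i K 1 ((\<lambda>j. undefined)(1 := n)) = h n" for n
    by (simp add: level_summand_def h_def)
  have h: "h summable_on {b..}"
    using summable_on_reindex_bij_betw[OF bij_betw_desc_tuples_1, of "level_summand m i K 1" b] summ unfolding e by simp
  have inf: "infsum (level_summand m i K 1) (desc_tuples 1 b) = infsum h {b..}"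
    using infsum_reindex_bij_betw[OF bij_betw_desc_tuples_1, of "level_summand m i K 1" b] unfolding e by simp
  obtain B where B: "B > 0" "\<And>k. norm (iqfact q k) \<le> B" using iqfact_bounded by blast
  have "(\<lambda>M. \<Sum>\<^sub>\<infinity>N\<in>{b..}. h N * iqfact q (int M - N)) \<longlonglongrightarrow> (\<Sum>\<^sub>\<infinity>N\<in>{b..}. h N * ?P)"
  proof (rule tannery)
    show "(\<lambda>N. norm (h N) * B) summable_on {b..}"
      using h by (intro summable_on_cmult_left) (simp add: summable_on_iff_abs_summable_on_complex)
    show "(\<lambda>M. h N * iqfact q (int M - N)) \<longlonglongrightarrow> h N * ?P" for N
      using iqfact_tendsto[of "- N"] by (intro tendsto_intros) simp
    show "norm (h N * iqfact q (int M - N)) \<le> norm (h N) * B" for M N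
      unfolding norm_mult using B by (intro mult_left_mono) auto
  qed
  also have "(\<lambda>M. \<Sum>\<^sub>\<infinity>N\<in>{b..}. h N * iqfact q (int M - N)) = (\<lambda>M. level m i K 0 (int M))"
  proof
    fix M :: nat
    have "(\<Sum>\<^sub>\<infinity>N\<in>{b..}. h N * iqfact q (int M - N)) = (\<Sum>\<^sub>\<infinity>N\<in>{b..int M}. h N * iqfact q (int M - N))"
      by (rule infsum_cong_neutral) auto
    also have "\<dots> = (\<Sum>N\<in>{b..int M}. q powi level_exp m i (Suc 0) N * (iqfact q (int M - N) * level m i K (Suc 0) N))"
      by (simp add: h_def mult_ac)
    also have "\<dots> = level m i K 0 (int M)"
      by (rule level_step[OF b]) (use \<open>1 \<le> K\<close> in simp)
    finally show "(\<Sum>\<^sub>\<infinity>N\<in>{b..}. h N * iqfact q (int M - N)) = level m i K 0 (int M)" .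
  qed
  finally have "infsum h {b..} * ?P = 
    (\<Sum>k\<le>i. q ^ (m * k) * (\<Sum>\<^sub>\<infinity>n. (-1) powi n * q powi ((int K + 1) * n\<^sup>2 + (int K * int m - 1 - int i + 2 * int k) * n)))
      * (?P * ?P)"
    unfolding infsum_cmult_left' using level_0_tendsto[OF \<open>i \<le> K\<close>] by (rule LIMSEQ_unique)
  then show ?thesis unfolding inf using qpoch_inf_self_nz by (simp add: field_simps)
qed

section \<open>Translation to the q-Pochhammer notation of the statement\<close>

lemma prod_powi: "finite A \<Longrightarrow> (\<Prod>l\<in>A. q powi f l) = q powi (\<Sum>l\<in>A. f l)"
  by (induction A rule: finite_induct) (simp_all add: qpow_add)

lemma qpoch_self: "0 \<le> k \<Longrightarrow> qpoch q q k = qfact q (nat k)"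
  by (simp add: qpoch_nonneg norm_q qfact_eq_prod)

lemma qfact_square: "qfact (q\<^sup>2) k = qfact q k * (\<Prod>j<k. 1 - - q * q ^ j)"
proof (induction k)
  case (Suc k)
  have "1 - (q\<^sup>2) ^ Suc k = (1 - q ^ Suc k) * (1 - - q * q ^ k)"
    by (simp add: algebra_simps power2_eq_square power_mult_distrib)
  then show ?case by (simp only: qfact_Suc Suc prod.lessThan_Suc mult_ac)
qed simp

text \<open>The binomial's denominator \<open>(q^2;q^2)_(m+2t)\<close> factors as
  \<open>(q)_(m+2t) (-q)_(m+2t)\<close>, and the second factor cancels. For \<open>t > 0\<close> the
  lower index exceeds the upper one and both sides vanish.\<close>

lemma qpoch_qbinom_eq_beta_coeff:
  assumes "0 \<le> int m + 2 * t"
  shows "qpoch (- q) q (int m + 2 * t) * qbinom (q\<^sup>2) (int m + t) (int m + 2 * t) = beta_coeff (int m) t"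
proof (cases "t \<le> 0")
  case True
  interpret q2: nome "q\<^sup>2" by (rule nome_power) simp
  define k where "k = nat (int m + 2 * t)"
  define P where "P = (\<Prod>j<k. 1 - - q * q ^ j)"
  have "qpoch (- q) q (int m + 2 * t) = P"
    unfolding P_def k_def using assms norm_q by (intro qpoch_nonneg) auto
  moreover have "qbinom (q\<^sup>2) (int m + t) (int m + 2 * t)
     = qfact (q\<^sup>2) (nat (int m + t)) / (qfact q k * P * qfact (q\<^sup>2) (nat (- t)))"
    unfolding P_def qfact_square[symmetric] using True assms by (simp add: qbinom_def q2.qpoch_self k_def)
  moreover have "P \<noteq> 0"
    using q2.qfact_nz[of k] unfolding qfact_square P_def[symmetric] by auto
  moreover have "beta_coeff (int m) t = qfact (q\<^sup>2) (nat (int m + t)) / (qfact q k * qfact (q\<^sup>2) (nat (- t)))"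
    using True assms by (simp add: beta_coeff_def iqfact_def k_def)
  ultimately show ?thesis by simp
next
  case False
  then show ?thesis by (simp add: qbinom_def beta_coeff_def)
qed

text \<open>On descending tuples the differences and \<open>m + 2 * s (Suc K)\<close> are
  nonnegative, so every \<open>qpoch\<close> is a finite product and matches \<open>iqfact\<close>
  or \<open>beta_coeff\<close>.\<close>

lemma summand_eq:
  assumes "1 \<le> K" "i \<le> K" and s: "s \<in> desc_tuples (Suc K) b" and b: "\<forall>N\<ge>b. 0 \<le> int m + 2 * N"
  shows "q powi ((\<Sum>j=1..Suc K. (s j)\<^sup>2) + int m * (\<Sum>j=1..K. s j) - (\<Sum>j=1..i. s j) + s K - 2 * s (Suc K))
      * qpoch (- q) q (int m + 2 * s (Suc K))
      / ((\<Prod>j=1..K-1. qpoch q q (s j - s (j + 1))) * qpoch (q\<^sup>2) (q\<^sup>2) (s K - s (Suc K)))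
      * (- 1) powi (s (Suc K)) * qbinom (q\<^sup>2) (int m + s (Suc K)) (int m + 2 * s (Suc K))
    = summand m i K s"
proof -
  interpret q2: nome "q\<^sup>2" by (rule nome_power) simp
  define t where "t = s (Suc K)"
  have desc: "s (Suc j) \<le> s j" if "j \<in> {1..K}" for j
    using s that by (auto simp: desc_tuples_def)
  have t: "0 \<le> int m + 2 * t"
    using s b by (auto simp: desc_tuples_def t_def)
  have last: "1 / qpoch (q\<^sup>2) (q\<^sup>2) (s K - t) = iqfact (q\<^sup>2) (s K - t)"
    using desc[of K] \<open>1 \<le> K\<close> by (simp add: q2.qpoch_self iqfact_def t_def)
  have "(\<Prod>j=1..<K. iqfact q (s j - s (j + 1))) = (\<Prod>j=1..<K. 1 / qpoch q q (s j - s (j + 1)))"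
  proof (rule prod.cong)
    fix j assume "j \<in> {1..<K}"
    then show "iqfact q (s j - s (j + 1)) = 1 / qpoch q q (s j - s (j + 1))"
      using desc[of j] by (simp add: iqfact_def qpoch_self)
  qed simp
  also have "\<dots> = 1 / (\<Prod>j=1..<K. qpoch q q (s j - s (j + 1)))"
    by (simp add: prod_dividef)
  also have "(\<Prod>j=1..<K. qpoch q q (s j - s (j + 1))) = (\<Prod>j=1..K-1. qpoch q q (s j - s (j + 1)))"
    using \<open>1 \<le> K\<close> by (intro prod.cong) auto
  finally have prod: "(\<Prod>j=1..<K. iqfact q (s j - s (j + 1))) = 1 / (\<Prod>j=1..K-1. qpoch q q (s j - s (j + 1)))" .
  have "(\<Sum>j=1..K. of_bool (j \<le> i) * s j) = (\<Sum>j=1..i. s j)"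
    by (rule sum.mono_neutral_cong_right) (use \<open>i \<le> K\<close> in auto)
  then have L: "(\<Sum>l=1..K. level_exp m i l (s l)) = (\<Sum>j=1..K. (s j)\<^sup>2) + int m * (\<Sum>j=1..K. s j) - (\<Sum>j=1..i. s j)"
    by (simp add: level_exp_def sum.distrib sum_subtractf left_diff_distrib sum_distrib_left)
  have "q powi ((\<Sum>j=1..Suc K. (s j)\<^sup>2) + int m * (\<Sum>j=1..K. s j) - (\<Sum>j=1..i. s j) + s K - 2 * t)
     = (\<Prod>l=1..K. q powi level_exp m i l (s l)) * q powi s K * q powi (t\<^sup>2 - 2 * t)"
    unfolding prod_powi[OF finite_atLeastAtMost] qpow_add L by (simp add: t_def algebra_simps)
  moreover have "summand m i K s = (\<Prod>l=1..K. q powi level_exp m i l (s l)) * q powi s K * q powi (t\<^sup>2 - 2 * t)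
     * (1 / (\<Prod>j=1..K-1. qpoch q q (s j - s (j + 1)))) * (1 / qpoch (q\<^sup>2) (q\<^sup>2) (s K - t))
     * (- 1) powi t * (qpoch (- q) q (int m + 2 * t) * qbinom (q\<^sup>2) (int m + t) (int m + 2 * t))"
    unfolding summand_def prod qpoch_qbinom_eq_beta_coeff[OF t] last t_def[symmetric] by (simp add: mult_ac)
  ultimately show ?thesis unfolding t_def[symmetric] by simp
qed

end

section \<open>Assembly of the identity\<close>

theorem theorem1p21:
  fixes q :: complex and m r i :: nat
  assumes "norm q < 1" and "q \<noteq> 0"
    and "r \<ge> 2" and "i < r"
  shows "((\<lambda>s.
            q powi ((\<Sum>j=1..r. (s j)\<^sup>2) + int m * (\<Sum>j=1..r-1. s j)
                      - (\<Sum>j=1..i. s j) + s (r - 1) - 2 * s r)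
              * qpoch (- q) q (int m + 2 * s r)
              / ((\<Prod>j=1..r-2. qpoch q q (s j - s (j + 1)))
                   * qpoch (q\<^sup>2) (q\<^sup>2) (s (r - 1) - s r))
              * (- 1) powi (s r) * qbinom (q\<^sup>2) (int m + s r) (int m + 2 * s r))
          has_sum
          (\<Sum>k=0..i. q ^ (m * k) *
             (qpoch_inf_list
                [q ^ (2 * r),
                 q powi ((int m + 1) * (int r - 1) - int i + 2 * int k),
                 q powi ((1 - int m) * int r + int m + int i - 2 * int k + 1)]
                (q ^ (2 * r))
              / qpoch_inf q q)))
         (desc_tuples r (- \<lfloor>real m / 2\<rfloor>))"
proof -
  interpret nome q by unfold_locales fact+
  obtain K where r: "r = Suc K" and K: "1 \<le> K" "i \<le> K"
    using assms by (cases r) auto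
  \<comment> \<open>\<open>b\<close> is the least integer with \<open>m + 2b >= 0\<close>; this
    yields both bounds below.\<close>
  define b where "b = - \<lfloor>real m / 2\<rfloor>"
  have b_less: "\<forall>N<b. 2 * N + int m < 0" and b_ge: "\<forall>N\<ge>b. 0 \<le> int m + 2 * N"
    unfolding b_def by linarith+
  have summ: "summand m i K summable_on desc_tuples (Suc K) b"
    by (rule summand_summable[OF K(1)])
  note step = desc_tuples_Suc[OF K(1) summ, unfolded summand_step[OF b_less K]]
  note step1 = level_summand_infsum[OF b_less K(1) order.refl step(1)]
  have "infsum (summand m i K) (desc_tuples (Suc K) b) =
    (\<Sum>k\<le>i. q ^ (m * k) * (\<Sum>\<^sub>\<infinity>n. (-1) powi n * q powi ((int K + 1) * n\<^sup>2 + (int K * int m - 1 - int i + 2 * int k) * n)))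
      * (1 / qpoch_inf q q)"
    unfolding step(2) conjunct2[OF step1] by (rule level_summand_1_infsum[OF b_less K conjunct1[OF step1]])
  also have "\<dots> = (\<Sum>k=0..i. q ^ (m * k) *
             (qpoch_inf_list
                [q ^ (2 * r),
                 q powi ((int m + 1) * (int r - 1) - int i + 2 * int k),
                 q powi ((1 - int m) * int r + int m + int i - 2 * int k + 1)]
                (q ^ (2 * r))
              / qpoch_inf q q))"
  proof -
    have "(\<Sum>\<^sub>\<infinity>n. (-1) powi n * q powi ((int K + 1) * n\<^sup>2 + (int K * int m - 1 - int i + 2 * int k) * n))
      = qpoch_inf_list
                [q ^ (2 * r),
                 q powi ((int m + 1) * (int r - 1) - int i + 2 * int k),
                 q powi ((1 - int m) * int r + int m + int i - 2 * int k + 1)]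
                (q ^ (2 * r))" for k
    proof -
      \<comment> \<open>Since \<open>r = K + 1\<close>, completing \<open>r * n^2\<close> to
        \<open>r * (n^2 - n)\<close> adds \<open>r\<close> to the linear coefficient, which then
        becomes \<open>?e\<close>.\<close>
      let ?e = "(int m + 1) * (int r - 1) - int i + 2 * int k"
      have "(int K + 1) * n\<^sup>2 + (int K * int m - 1 - int i + 2 * int k) * n = int r * (n\<^sup>2 - n) + ?e * n" for n
        by (simp add: r algebra_simps)
      moreover have "(1 - int m) * int r + int m + int i - 2 * int k + 1 = 2 * int r - ?e"
        by (simp add: algebra_simps)
      ultimately show ?thesis
        using jacobi_triple_product[of r ?e] r by (simp only:)
    qed
    then show ?thesis by (simp add: sum_divide_distrib atMost_atLeast0)
  qed
  finally have "(summand m i K has_sum (\<Sum>k=0..i. q ^ (m * k) *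
             (qpoch_inf_list
                [q ^ (2 * r),
                 q powi ((int m + 1) * (int r - 1) - int i + 2 * int k),
                 q powi ((1 - int m) * int r + int m + int i - 2 * int k + 1)]
                (q ^ (2 * r))
              / qpoch_inf q q))) (desc_tuples r b)"
    using summ by (simp add: has_sum_iff r)
  then show ?thesis
    unfolding b_def[symmetric]
    by (rule has_sum_cong[THEN iffD1, rotated])
       (use summand_eq[OF K _ b_ge] in \<open>simp add: r numeral_2_eq_2\<close>)
qed

end
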